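(* Let $K\subset\mathbb{R}^d\subset\mathbb{C}^d$ be a compact convex polytope of dimension $d$, and let $\mathcal{S}(K)$ be the finite collection of supporting simplices and strips of $K$ described in the context. Then for all $z\in\mathbb{C}^d$, $$V_K(z)=\max\{V_S(z)\colon S\in\mathcal{S}(K)\}.$$
   Context: The Lelong class $\mathcal{L}$ is the set of plurisubharmonic functions $u$ on $\mathbb{C}^d$ such that $u(z)\le \log^+|z|+C$ for some constant $C$, where $\log^+|z|=\max\{0,\log|z|\}$. For a set $E\subset\mathbb{C}^d$ (possibly unbounded), the extremal function is $V_E(z)=\sup\{u(z)\colon u\in\mathcal{L},\ u\le 0 \text{ on } E\}$. For compact $E$ this coincides with the Siciak–Zaharjuta extremal function $\sup\{\frac{1}{\deg p}\log^+|p(z)|\colon p \text{ a complex polynomial},\ \sup_E|p|\le 1\}$. A strip in $\mathbb{R}^d$ is a set $L^{-1}(A)$, where $L\colon\mathbb{R}^d\to\mathbb{R}^j$ is a linear map of rank $j$, $j\in\{1,\dots,d\}$, and $A\subset\mathbb{R}^j$ is a compact convex set of dimension $j$. After an orthogonal change of coordinates such a strip has the form $A\times\mathbb{R}^{d-j}$, and $A$ is called its ($j$-dimensional) orthogonal cross-section. A face of a $d$-dimensional polytope means a face of codimension $1$ (a facet). The facets of a strip $L^{-1}(A)$ whose cross-section $A$ is a simplex are the sets $L^{-1}(G)$ with $G$ a facet of $A$. $\mathcal{S}(K)$ consists of two kinds of sets: - every $d$-dimensional simplex $S\supseteq K$ each of whose facets contains a facet of $K$; - every strip $S\supseteq K$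 whose orthogonal cross-section is a $j$-dimensional simplex with $j<d$, and each of whose facets contains a facet of $K$. *)

theory Defs
  imports "HOL-Analysis.Analysis" "HOL-Library.Extended_Real" "HOL-Library.Extended_Nonnegative_Real"
begin

definition usc :: "('a::topological_space \<Rightarrow> ereal) \<Rightarrow> bool" where
  "usc u \<longleftrightarrow> (\<forall>c::ereal. open {w. u w < c})"

text \<open>Circle mean of u over the circle a + e^{i theta} b, computed as
  M - (1/(2 pi)) * integral of (M - u), valid for any real upper bound M of u on the circle.\<close>

definition psh :: "(complex ^ 'd \<Rightarrow> ereal) \<Rightarrow> bool" where
  "psh u \<longleftrightarrow> usc u \<and> (\<forall>z. u z \<noteq> \<infinity>) \<and> (\<exists>z. u z \<noteq> -\<infinity>) \<and>
     (\<forall>a b::complex^'d. \<forall>M::real.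
        (\<forall>\<theta>. u (a + cis \<theta> *s b) \<le> ereal M) \<longrightarrow>
        u a \<le> ereal M - ereal (1 / (2 * pi)) *
           enn2ereal (\<integral>\<^sup>+ \<theta>. e2ennreal (ereal M - u (a + cis \<theta> *s b))
                        * indicator {0..2*pi} \<theta> \<partial>lborel))"

definition logplus :: "real \<Rightarrow> real" where
  "logplus r = (if r \<le> 1 then 0 else ln r)"

definition lelong :: "(complex ^ 'd \<Rightarrow> ereal) \<Rightarrow> bool" where
  "lelong u \<longleftrightarrow> psh u \<and> (\<exists>C::real. \<forall>z. u z \<le> ereal (logplus (norm z) + C))"

definition extremal :: "(complex ^ 'd) set \<Rightarrow> complex ^ 'd \<Rightarrow> ereal" where
  "extremal E z = Sup {u z | u. lelong u \<and> (\<forall>w\<in>E. u w \<le> 0)}"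

definition cvec :: "real ^ 'd \<Rightarrow> complex ^ 'd" where
  "cvec x = (\<chi> i. complex_of_real (x $ i))"

text \<open>A strip L^{-1}(A) with L : R^d \<rightarrow> R^j of rank j is represented with L : R^d \<rightarrow> R^d linear,
  j = dim (range L), and A \<subseteq> range L (range L is identified with R^j).\<close>

definition supporting_simplex :: "(real ^ 'd) set \<Rightarrow> (real ^ 'd) set \<Rightarrow> bool" where
  "supporting_simplex K S \<longleftrightarrow> (int CARD('d)) simplex S \<and> K \<subseteq> S \<and>
     (\<forall>G. G facet_of S \<longrightarrow> (\<exists>F. F facet_of K \<and> F \<subseteq> G))"

definition supporting_strip :: "(real ^ 'd) set \<Rightarrow> (real ^ 'd) set \<Rightarrow> bool" where
  "supporting_strip K S \<longleftrightarrow> (\<exists>(L::real^'d \<Rightarrow> real^'d) A.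
     linear L \<and> 1 \<le> dim (range L) \<and> dim (range L) < CARD('d) \<and>
     A \<subseteq> range L \<and> (int (dim (range L))) simplex A \<and>
     S = L -` A \<and> K \<subseteq> S \<and>
     (\<forall>G. G facet_of A \<longrightarrow> (\<exists>F. F facet_of K \<and> F \<subseteq> L -` G)))"

definition SK :: "(real ^ 'd) set \<Rightarrow> (real ^ 'd) set set" where
  "SK K = {S. supporting_simplex K S \<or> supporting_strip K S}"

end

theory Submission
  imports Defs "HOL-Complex_Analysis.Complex_Analysis"
begin

text \<open>Write \<open>K\<close> as the set where the affine functions \<open>l i = b i - a i \<bullet> x\<close> are nonnegative, one for each
  facet. A point \<open>z\<close> and \<open>t > 0\<close> determine, for every real centre \<open>x\<close>, a unique ellipse
  \<open>f \<zeta> = x + \<zeta> c + cnj c / \<zeta>\<close> with \<open>f (exp t) = z\<close>. The image of the unit circle lies in \<open>K\<close> iff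
  \<open>(sinh t)^2 * l i x \<ge> cosh t * |l i z| - Re (l i z)\<close> for all \<open>i\<close>, a system of \<^emph>\<open>linear\<close> inequalities in \<open>x\<close>.
  If it is solvable, the maximum principle along the ellipse gives \<open>V\<^sub>K z \<le> t\<close>. Otherwise Farkas' lemma yields
  coefficients \<open>\<mu> i > 0\<close> of minimal support with \<open>\<Sum> \<mu> i * l i = 1\<close> and \<open>cosh t < \<Sum> \<mu> i * |l i z|\<close>. Minimality
  makes the \<open>\<mu> i * l i\<close> the barycentric coordinates of a supporting simplex or strip \<open>S\<close>, and
  \<open>arcosh (\<Sum> \<mu> i * |l i|)\<close> is a Lelong function vanishing on \<open>S\<close>, so that \<open>V\<^sub>S z > t\<close>.\<close>

text \<open>\<open>psh\<close> speaks of circles in complex lines, so restricting such a function to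
  an ellipse does not give a subharmonic function by definition. The maximum principle is therefore
  run in two variables, on a thin neighbourhood of the hyperbola \<open>w1 * w2 = 1\<close>, with
  penalty terms. Linearity in the centre comes from a cancellation. On the unit circle
  \<open>l i (f \<zeta>)\<close> oscillates about \<open>l i x\<close> with amplitude
  \<open>2 * |\<gamma>|\<close>, where \<open>Re \<gamma>\<close> is affine in \<open>l i x\<close>
  and \<open>Im \<gamma>\<close> is independent of it; in
  \<open>4 * |\<gamma>|^2 \<le> (l i x)^2\<close> the terms containing \<open>l i x\<close> complete
  to a square because \<open>cosh^2 = 1 + sinh^2\<close>. The same identity simplifies the weighted
  sum of the inequalities, since the weights make both \<open>l i x\<close> and
  \<open>Re (l i z)\<close> sum to 1. An alternative for each real \<open>t > 0\<close> is enough: a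
  \<open>t\<close> strictly between the two sides of the theorem would contradict both branches, so
  no optimal ellipse has to be found.\<close>

section \<open>Circle means of plurisubharmonic functions\<close>

lemma circle_mean_holomorphic:
  assumes "f holomorphic_on cball 0 1"
  shows "((\<lambda>\<theta>. f (cis \<theta>)) has_integral (2 * pi) *\<^sub>R f 0) {0..2*pi}"
proof -
  have "((\<lambda>u. f u / (u - 0)) has_contour_integral (2 * of_real pi * \<i> * f 0)) (circlepath 0 1)"
    by (rule Cauchy_integral_circlepath_simple) (use assms in auto)
  hence "((\<lambda>t. f (cis t) / cis t * \<i> * cis t) has_integral (2 * of_real pi * \<i> * f 0)) {0..2*pi}"
    unfolding circlepath_def by (subst (asm) has_contour_integral_part_circlepath_iff) auto
  hence "((\<lambda>t. (-\<i>) * (f (cis t) / cis t * \<i> * cis t)) has_integral (-\<i>) * (2 * of_real pi * \<i> * f 0)) {0..2*pi}"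
    by (rule has_integral_mult_right)
  thus ?thesis
    by (simp add: scaleR_conv_of_real field_simps)
qed

text \<open>The only form in which the submean inequality of \<open>psh\<close> is used. With
  \<open>M\<close> a bound for \<open>|Re g|\<close> on the circle, \<open>M - u\<close> dominates
  \<open>M - Re g \<ge> 0\<close>, whose integral is explicit by the mean value property.\<close>

lemma psh_le_harmonic_majorant:
  fixes a b :: "complex ^ 'd"
  assumes u: "psh u" and g: "g holomorphic_on cball 0 1"
    and le: "\<And>\<xi>. norm \<xi> = 1 \<Longrightarrow> u (a + \<xi> *s b) \<le> ereal (Re (g \<xi>))"
  shows "u a \<le> ereal (Re (g 0))"
proof -
  have gc: "continuous_on (sphere 0 1) (\<lambda>\<xi>. Re (g \<xi>))"
    using holomorphic_on_imp_continuous_on[OF g]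
    by (intro continuous_intros) (auto intro: continuous_on_subset)
  have "compact ((\<lambda>\<xi>. Re (g \<xi>)) ` sphere 0 1)"
    by (intro compact_continuous_image gc) auto
  hence "bounded ((\<lambda>\<xi>. Re (g \<xi>)) ` sphere 0 1)" by (rule compact_imp_bounded)
  then obtain M where M: "\<forall>x\<in>sphere 0 1. \<bar>Re (g x)\<bar> \<le> M"
    unfolding bounded_iff by auto
  define N where "N = (\<integral>\<^sup>+ \<theta>. e2ennreal (ereal M - u (a + cis \<theta> *s b))
                        * indicator {0..2*pi} \<theta> \<partial>lborel)"
  define P where "P = (\<lambda>\<theta>. M - Re (g (cis \<theta>)))"
  have upb: "u (a + cis \<theta> *s b) \<le> ereal M" for \<theta>
    by (rule order_trans[OF le]) (use bspec[OF M, of "cis \<theta>"] in auto)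
  have 1: "u a \<le> ereal M - ereal (1 / (2 * pi)) * enn2ereal N"
    using u upb unfolding psh_def N_def by blast
  have "((\<lambda>\<theta>. Re (g (cis \<theta>))) has_integral Re ((2 * pi) *\<^sub>R g 0)) {0..2*pi}"
    using circle_mean_holomorphic[OF g] by (rule has_integral_Re)
  hence PI: "(P has_integral (M * (2*pi) - 2 * pi * Re (g 0))) {0..2*pi}"
    unfolding P_def using has_integral_const_real[of M 0 "2*pi"]
    by (intro has_integral_diff) (auto simp: mult.commute)
  have P0: "P \<theta> \<ge> 0" for \<theta>
    using bspec[OF M, of "cis \<theta>"] by (auto simp: P_def)
  have Pc: "continuous_on {0..2*pi} P"
    unfolding P_def
    by (intro continuous_intros continuous_on_compose2[OF gc, of _ cis, simplified] ) auto
  have "(\<integral>\<^sup>+ \<theta>. ennreal (P \<theta>) * indicator {0..2*pi} \<theta> \<partial>lborel) = ennreal (M * (2*pi) - 2 * pi * Re (g 0))"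
    by (rule nn_integral_has_integral_lebesgue') (use P0 PI in auto)
  moreover have "(\<integral>\<^sup>+ \<theta>. ennreal (P \<theta>) * indicator {0..2*pi} \<theta> \<partial>lborel) \<le> N"
    unfolding N_def
  proof (intro nn_integral_mono mult_right_mono)
    fix \<theta>
    have "ereal (P \<theta>) \<le> ereal M - u (a + cis \<theta> *s b)"
      using le[of "cis \<theta>"] unfolding P_def
      by (cases "u (a + cis \<theta> *s b)") auto
    thus "ennreal (P \<theta>) \<le> e2ennreal (ereal M - u (a + cis \<theta> *s b))"
      by (metis e2ennreal_mono e2ennreal_ereal)
  qed auto
  ultimately have "ennreal (M * (2*pi) - 2 * pi * Re (g 0)) \<le> N" by simp
  hence "enn2ereal (ennreal (M * (2*pi) - 2 * pi * Re (g 0))) \<le> enn2ereal N"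
    by (simp add: less_eq_ennreal.rep_eq)
  moreover have "0 \<le> M * (2*pi) - 2 * pi * Re (g 0)"
    using PI P0 by (rule has_integral_nonneg)
  ultimately have "ereal (M * (2*pi) - 2 * pi * Re (g 0)) \<le> enn2ereal N"
    by simp
  hence "ereal (1 / (2 * pi)) * ereal (M * (2*pi) - 2 * pi * Re (g 0)) \<le> ereal (1 / (2 * pi)) * enn2ereal N"
    by (intro ereal_mult_left_mono) auto
  moreover have "ereal (1 / (2 * pi)) * ereal (M * (2*pi) - 2 * pi * Re (g 0)) = ereal (M - Re (g 0))"
    by (simp add: field_simps)
  ultimately have "ereal (M - Re (g 0)) \<le> ereal (1 / (2 * pi)) * enn2ereal N" by simp
  hence "ereal M - ereal (1 / (2 * pi)) * enn2ereal N \<le> ereal M - ereal (M - Re (g 0))"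
    by (intro ereal_minus_mono) auto
  also have "\<dots> = ereal (Re (g 0))" by simp
  finally show ?thesis using 1 by simp
qed

text \<open>The constant coefficients of \<open>p\<close> and \<open>q\<close> are split off;
  \<open>z * cnj z = 1\<close> then cancels the factor \<open>z\<close> common to both
  remainders.\<close>

lemma mult_cnj_poly_on_circle:
  fixes p q :: "complex poly"
  shows "\<exists>r s. \<forall>z. norm z = 1 \<longrightarrow> poly p z * cnj (poly q z) = poly r z + cnj (poly s z)"
proof (induction q arbitrary: p)
  case 0
  then show ?case by (intro exI[of _ 0]) auto
next
  case (pCons a q)
  obtain c p' where p: "p = pCons c p'" by (cases p)
  obtain r s where rs: "\<And>z. norm z = 1 \<Longrightarrow> poly p' z * cnj (poly q z) = poly r z + cnj (poly s z)"
    using pCons.IH[of p'] by blast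
  have "poly p z * cnj (poly (pCons a q) z)
      = poly (smult (cnj a) p + r) z + cnj (poly (smult (cnj c) (pCons 0 q) + s) z)"
    if z: "norm z = 1" for z
  proof -
    have "z * cnj z = 1" using z by (simp add: complex_norm_square[symmetric])
    hence "poly p z * cnj (poly (pCons a q) z)
       = cnj a * poly p z + c * cnj (z * poly q z) + poly p' z * cnj (poly q z)"
      unfolding p by (simp add: algebra_simps)
    thus ?thesis using rs[OF z] by simp
  qed
  thus ?case by blast
qed

text \<open>Gives a Stone-Weierstrass approximant on the circle a harmonic extension to the disc.
  Products are handled by \<open>2 * Re v * Re w = Re (v * w + v * cnj w)\<close>.\<close>

lemma real_polynomial_function_on_circle:
  fixes f :: "complex \<Rightarrow> real"
  assumes "real_polynomial_function f"
  shows "\<exists>q. \<forall>z. norm z = 1 \<longrightarrow> f z = Re (poly q z)"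
  using assms
proof (induction rule: real_polynomial_function.induct)
  case (linear f)
  interpret f: bounded_linear f by fact
  have "f z = Re (poly [:0, Complex (f 1) (- f \<i>):] z)" for z
  proof -
    have "z = Re z *\<^sub>R 1 + Im z *\<^sub>R \<i>" by (simp add: complex_eq_iff)
    hence "f z = Re z * f 1 + Im z * f \<i>" by (metis f.add f.scaleR real_scaleR_def)
    thus ?thesis by simp
  qed
  thus ?case by blast
next
  case (const c)
  show ?case by (intro exI[of _ "[:complex_of_real c:]"]) auto
next
  case (add f g)
  then obtain p q where "\<forall>z. norm z = 1 \<longrightarrow> f z = Re (poly p z)" "\<forall>z. norm z = 1 \<longrightarrow> g z = Re (poly q z)"
    by blast
  thus ?case by (intro exI[of _ "p + q"]) auto
next
  case (mult f g)
  then obtain p q where pq: "\<forall>z. norm z = 1 \<longrightarrow> f z = Re (poly p z)" "\<forall>z. norm z = 1 \<longrightarrow> g z = Re (poly q z)"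
    by blast
  obtain r s where rs: "\<forall>z. norm z = 1 \<longrightarrow> poly p z * cnj (poly q z) = poly r z + cnj (poly s z)"
    using mult_cnj_poly_on_circle by blast
  have "f z * g z = Re (poly (smult (1/2) (p * q + r + s)) z)" if z: "norm z = 1" for z
  proof -
    have "f z * g z = Re (poly p z) * Re (poly q z)" using pq z by simp
    also have "\<dots> = Re (poly p z * poly q z + poly p z * cnj (poly q z)) / 2" by simp
    also have "\<dots> = Re (poly p z * poly q z + (poly r z + cnj (poly s z))) / 2" using rs z by simp
    finally show ?thesis by simp
  qed
  thus ?case by blast
qed

text \<open>Rado's characterisation of subharmonicity: \<open>G\<close> is compared with \<open>Re q\<close> for a polynomial \<open>q\<close>
  approximating it on the circle.\<close>

lemma submean_of_local_support:
  fixes G :: "complex \<Rightarrow> real"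
  assumes G: "continuous_on UNIV G"
    and supp: "\<And>x. \<exists>F. \<exists>\<rho>>0. F holomorphic_on ball x \<rho> \<and> norm (F x) = exp (G x)
                 \<and> (\<forall>y\<in>ball x \<rho>. norm (F y) \<le> exp (G y))"
  shows "2 * pi * G 0 \<le> integral {0..2*pi} (\<lambda>\<theta>. G (cis \<theta>))"
proof (rule field_le_epsilon)
  fix e' :: real assume e': "e' > 0"
  \<comment> \<open>\<open>e\<close> is lost once at the centre and once under the integral, each
    time with the factor \<open>2 * pi\<close>.\<close>
  define e where "e = e' / (4 * pi)"
  have e: "e > 0" using e' by (simp add: e_def)
  obtain f where f: "real_polynomial_function f" "\<And>x. x \<in> sphere 0 1 \<Longrightarrow> \<bar>G x - f x\<bar> < e"
    using Stone_Weierstrass_real_polynomial_function[OF _ continuous_on_subset[OF G] e, of "sphere 0 1"]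
    by auto
  obtain q where q: "\<And>z. norm z = 1 \<Longrightarrow> f z = Re (poly q z)"
    using real_polynomial_function_on_circle[OF f(1)] by blast
  define D where "D = (\<lambda>z. G z - Re (poly q z))"
  have Dc: "continuous_on UNIV D"
    unfolding D_def by (intro continuous_intros G)
  have D_circle: "\<bar>D z\<bar> < e" if "norm z = 1" for z
    using f(2)[of z] q[OF that] that by (simp add: D_def)
  have "\<exists>x\<in>cball 0 1. \<forall>y\<in>cball 0 1. D y \<le> D x"
    by (intro continuous_attains_sup continuous_on_subset[OF Dc]) auto
  then obtain x0 where x0: "x0 \<in> cball 0 1" "\<And>y. y \<in> cball 0 1 \<Longrightarrow> D y \<le> D x0" by blast
  \<comment> \<open>Among the maximum points of \<open>D\<close> one farthest from 0 is taken. If it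
    were interior, a maximum point farther out would exist; so it lies on the circle, where
    \<open>D < e\<close>.\<close>
  define Z where "Z = cball 0 1 \<inter> D -` {D x0}"
  have "closed (D -` {D x0})"
    using Dc by (simp add: closed_vimage)
  hence "compact Z" unfolding Z_def by (intro compact_Int_closed) auto
  moreover have "x0 \<in> Z" using x0 by (simp add: Z_def)
  ultimately have "\<exists>x\<in>Z. \<forall>y\<in>Z. norm y \<le> norm x"
    by (intro continuous_attains_sup continuous_intros) auto
  then obtain x where x: "x \<in> Z" "\<And>y. y \<in> Z \<Longrightarrow> norm y \<le> norm x" by blast
  have "norm x = 1"
  proof (rule ccontr)
    assume "norm x \<noteq> 1"
    hence nx: "norm x < 1" using x by (auto simp: Z_def)
    obtain F \<rho> where F: "\<rho> > 0" "F holomorphic_on ball x \<rho>" "norm (F x) = exp (G x)"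
       "\<And>y. y \<in> ball x \<rho> \<Longrightarrow> norm (F y) \<le> exp (G y)" using supp[of x] by blast
    define r where "r = min \<rho> (1 - norm x)"
    have r: "r > 0" "r \<le> \<rho>" "r \<le> 1 - norm x" using F nx by (auto simp: r_def)
    have sub: "y \<in> cball 0 1" if "y \<in> ball x r" for y
    proof -
      have "norm y \<le> norm x + norm (x - y)" by (metis norm_triangle_sub add.commute norm_minus_commute)
      thus ?thesis using that r by (simp add: dist_norm)
    qed
    \<comment> \<open>\<open>norm (H y) \<le> exp (D y)\<close> with equality at \<open>x\<close>
      turns a maximum of \<open>D\<close> at \<open>x\<close> into a maximum of the modulus of a
      holomorphic function.\<close>
    define H where "H = (\<lambda>y. F y * exp (- poly q y))"
    have Hn: "norm (H y) \<le> exp (D y)" if "y \<in> ball x r" for y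
    proof -
      have "norm (F y) \<le> exp (G y)" using F(4)[of y] that r by auto
      hence "norm (F y) * exp (- Re (poly q y)) \<le> exp (G y) * exp (- Re (poly q y))"
        by (intro mult_right_mono) auto
      thus ?thesis by (simp add: H_def norm_mult D_def flip: exp_add)
    qed
    have Hx: "norm (H x) = exp (D x)"
      using F(3) by (simp add: H_def norm_mult D_def flip: exp_add)
    have Dx: "D x = D x0" using x by (simp add: Z_def)
    have "H constant_on ball x r"
    proof (rule maximum_modulus_principle[where U = "ball x r" and \<xi> = x])
      show "H holomorphic_on ball x r" unfolding H_def
        by (intro holomorphic_intros holomorphic_on_subset[OF F(2)]) (use r in auto)
      fix z assume z: "z \<in> ball x r"
      show "norm (H z) \<le> norm (H x)"
        using Hn[OF z] x0(2)[OF sub[OF z]] unfolding Hx Dx by (smt (verit) exp_le_cancel_iff)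
    qed (use r in auto)
    define y where "y = (if x = 0 then of_real (r/2) else x + of_real (r / 2) * sgn x)"
    have y: "y \<in> ball x r" "norm y > norm x"
    proof -
      have "y = of_real (norm x + r/2) * sgn x" if "x \<noteq> 0"
        using that by (simp add: y_def sgn_eq field_simps)
      hence "norm y = norm x + r / 2"
        using r by (cases "x = 0") (auto simp: y_def norm_mult norm_sgn simp flip: of_real_add)
      thus "norm y > norm x" using r by simp
      show "y \<in> ball x r"
        using r by (auto simp: y_def dist_norm norm_mult norm_sgn)
    qed
    have "H y = H x"
      using \<open>H constant_on ball x r\<close> y(1) r by (metis centre_in_ball constant_on_def)
    hence "exp (D x0) \<le> exp (D y)" using Hn[OF y(1)] Hx Dx by simp
    hence "D y = D x0" using x0(2)[OF sub[OF y(1)]] by simp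
    hence "y \<in> Z" using sub[OF y(1)] by (simp add: Z_def)
    thus False using x(2) y(2) by fastforce
  qed
  hence "D 0 < e" using x0(2)[of 0] D_circle[of x] x(1) by (auto simp: Z_def)
  have "((\<lambda>\<theta>. Re (poly q (cis \<theta>))) has_integral Re ((2 * pi) *\<^sub>R poly q 0)) {0..2*pi}"
    by (intro has_integral_Re circle_mean_holomorphic holomorphic_intros)
  hence *: "((\<lambda>\<theta>. Re (poly q (cis \<theta>)) - e) has_integral (2 * pi * Re (poly q 0) - e * (2 * pi))) {0..2*pi}"
    using has_integral_const_real[of e 0 "2*pi"] by (intro has_integral_diff) (auto simp: mult.commute)
  have "2 * pi * Re (poly q 0) - e * (2*pi) \<le> integral {0..2*pi} (\<lambda>\<theta>. G (cis \<theta>))"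
  proof (rule has_integral_le[OF * integrable_integral])
    show "(\<lambda>\<theta>. G (cis \<theta>)) integrable_on {0..2*pi}"
      by (intro integrable_continuous_real continuous_on_compose2[OF G] continuous_intros) auto
    show "Re (poly q (cis \<theta>)) - e \<le> G (cis \<theta>)" for \<theta>
      using D_circle[of "cis \<theta>"] by (simp add: D_def)
  qed
  moreover have "2 * pi * G 0 \<le> 2 * pi * (Re (poly q 0) + e)"
    using \<open>D 0 < e\<close> by (intro mult_left_mono) (auto simp: D_def)
  moreover have "4 * pi * e = e'" by (simp add: e_def)
  ultimately show "2 * pi * G 0 \<le> integral {0..2*pi} (\<lambda>\<theta>. G (cis \<theta>)) + e'"
    by (simp add: algebra_simps)
qed

text \<open>For a continuous real-valued \<open>u\<close> the bound \<open>M\<close> in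
  \<open>psh\<close> cancels and the ordinary circle mean remains.\<close>

lemma psh_ereal_of_continuous:
  fixes u :: "complex ^ 'd \<Rightarrow> real"
  assumes u: "continuous_on UNIV u"
    and mean: "\<And>a b. 2 * pi * u a \<le> integral {0..2*pi} (\<lambda>\<theta>. u (a + cis \<theta> *s b))"
  shows "psh (\<lambda>z. ereal (u z))"
  unfolding psh_def
proof (intro conjI allI impI)
  have "open {w. ereal (u w) < c}" for c
    using u by (intro open_Collect_less continuous_intros) auto
  thus "usc (\<lambda>z. ereal (u z))" unfolding usc_def by blast
next
  fix a b :: "complex ^ 'd" and M :: real
  assume M: "\<forall>\<theta>. ereal (u (a + cis \<theta> *s b)) \<le> ereal M"
  define I where "I = integral {0..2*pi} (\<lambda>\<theta>. u (a + cis \<theta> *s b))"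
  have "continuous_on UNIV (\<lambda>\<theta>. u (a + cis \<theta> *s b))"
    unfolding vector_scalar_mult_def
    by (intro continuous_on_compose2[OF u] continuous_intros) auto
  hence "((\<lambda>\<theta>. u (a + cis \<theta> *s b)) has_integral I) {0..2*pi}"
    unfolding I_def by (intro integrable_integral integrable_continuous_real) (rule continuous_on_subset, auto)
  hence PI: "((\<lambda>\<theta>. M - u (a + cis \<theta> *s b)) has_integral (M * (2*pi) - I)) {0..2*pi}"
    using has_integral_const_real[of M 0 "2*pi"]
    by (intro has_integral_diff) (auto simp: mult.commute)
  have "(\<integral>\<^sup>+ \<theta>. e2ennreal (ereal M - ereal (u (a + cis \<theta> *s b))) * indicator {0..2*pi} \<theta> \<partial>lborel)
      = (\<integral>\<^sup>+ \<theta>. ennreal (M - u (a + cis \<theta> *s b)) * indicator {0..2*pi} \<theta> \<partial>lborel)"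
    by simp
  also have "\<dots> = ennreal (M * (2*pi) - I)"
    by (rule nn_integral_has_integral_lebesgue') (use M PI in auto)
  finally have eq: "enn2ereal (\<integral>\<^sup>+ \<theta>. e2ennreal (ereal M - ereal (u (a + cis \<theta> *s b))) * indicator {0..2*pi} \<theta> \<partial>lborel)
      = ereal (M * (2*pi) - I)"
    using has_integral_nonneg[OF PI] M by simp
  show "ereal (u a) \<le> ereal M - ereal (1 / (2 * pi)) *
         enn2ereal (\<integral>\<^sup>+ \<theta>. e2ennreal (ereal M - ereal (u (a + cis \<theta> *s b))) * indicator {0..2*pi} \<theta> \<partial>lborel)"
    unfolding eq using mean[of a b, folded I_def] by (simp add: field_simps)
qed auto

section \<open>The maximum principle along an ellipse\<close>

text \<open>Without a maximum the open sets \<open>{w. f w < f y}\<close> would cover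
  \<open>S\<close>; in a finite subcover the \<open>y\<close> with the largest \<open>f y\<close>
  would be left uncovered.\<close>

lemma usc_minus_continuous_attains_sup:
  fixes u :: "'a::topological_space \<Rightarrow> ereal" and \<phi> :: "'a \<Rightarrow> real"
  assumes S: "compact S" "S \<noteq> {}" and u: "usc u" and \<phi>: "continuous_on UNIV \<phi>"
  shows "\<exists>x\<in>S. \<forall>y\<in>S. u y - ereal (\<phi> y) \<le> u x - ereal (\<phi> x)"
proof (rule ccontr)
  define f where "f = (\<lambda>y. u y - ereal (\<phi> y))"
  assume "\<not> ?thesis"
  hence lt: "\<And>x. x \<in> S \<Longrightarrow> \<exists>y\<in>S. f x < f y" by (auto simp: not_le f_def)
  have f_open: "open {w. f w < c}" for c
  proof -
    have "u w - ereal (\<phi> w) < c \<longleftrightarrow> u w < c + ereal (\<phi> w)" for w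
      by (cases "u w"; cases c) auto
    hence "{w. f w < c} = {w. u w < c + ereal (\<phi> w)}" by (simp add: f_def)
    \<comment> \<open>An intermediate level \<open>t\<close> separates the semicontinuous
      \<open>u\<close> from the continuous right-hand side.\<close>
    also have "\<dots> = (\<Union>t. {w. u w < t} \<inter> {w. t < c + ereal (\<phi> w)})"
      by (auto intro: less_trans dest: dense)
    also have "open \<dots>"
    proof (intro open_UN ballI open_Int)
      show "open {w. u w < t}" for t using u unfolding usc_def by blast
      have "continuous_on UNIV (\<lambda>w. c + ereal (\<phi> w))"
      proof (cases c)
        case (real r)
        have "continuous_on UNIV (\<lambda>w. ereal (r + \<phi> w))"
          by (intro continuous_intros \<phi>)
        thus ?thesis using real by simp
      qed auto
      thus "open {w. t < c + ereal (\<phi> w)}" for t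
        by (intro open_Collect_less) auto
    qed
    finally show ?thesis .
  qed
  have "S \<subseteq> (\<Union>y\<in>S. {w. f w < f y})"
    using lt by blast
  then obtain T where T: "T \<subseteq> S" "finite T" "S \<subseteq> (\<Union>y\<in>T. {w. f w < f y})"
    using compactE_image[OF S(1), of S "\<lambda>y. {w. f w < f y}"] f_open by auto
  have "T \<noteq> {}" using T S by auto
  hence "Max (f ` T) \<in> f ` T" using T by auto
  then obtain y where y: "y \<in> T" "f y = Max (f ` T)" by auto
  then obtain y' where "y' \<in> T" "f y < f y'" using T by blast
  thus False using y T by (metis Max_ge finite_imageI imageI leD)
qed

text \<open>The affine circle \<open>\<xi> \<mapsto> (p (1 + s \<xi>), q (1 - s \<xi>))\<close> is tangent to the hyperbola through
  \<open>(p, q)\<close>; along it the mean of the penalty term grows only like \<open>s ^ 4\<close>, while the mean of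
  \<open>- \<epsilon> |w1| ^ 2\<close> drops like \<open>s ^ 2\<close>.\<close>

lemma psh_near_hyperbola_no_interior_max:
  fixes u :: "complex ^ 'd \<Rightarrow> ereal" and a c c' :: "complex ^ 'd" and p q :: complex and R \<delta> \<epsilon> \<eta> k m :: real
  assumes u: "psh u" and pq: "1 < norm p" "norm p < R" "norm (p * q - 1) < \<delta>"
    and \<epsilon>: "\<epsilon> > 0" and k: "k \<ge> 0"
  defines "\<phi> \<equiv> \<lambda>w1 w2. (1 + \<eta>) * ln (norm w1) + k * (norm (w1 * w2 - 1))\<^sup>2 - \<epsilon> * (norm w1)\<^sup>2"
  assumes le: "\<And>w1 w2. 1 \<le> norm w1 \<Longrightarrow> norm w1 \<le> R \<Longrightarrow> norm (w1 * w2 - 1) \<le> \<delta> \<Longrightarrow>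
                  u (a + w1 *s c + w2 *s c') \<le> ereal (\<phi> w1 w2 + m)"
  shows "u (a + p *s c + q *s c') < ereal (\<phi> p q + m)"
proof -
  have "\<forall>\<^sub>F s in at_right (0::real). 1 < norm p * (1 - s)"
    using pq(1) by real_asymp
  moreover have "\<forall>\<^sub>F s in at_right (0::real). norm p * (1 + s) < R"
    using pq(2) by real_asymp
  moreover have "\<forall>\<^sub>F s in at_right (0::real). norm (p * q - 1) + norm (p * q) * s\<^sup>2 < \<delta>"
    using pq(3) by real_asymp
  moreover have "\<forall>\<^sub>F s in at_right (0::real). k * (norm q)\<^sup>2 * s\<^sup>2 < \<epsilon>"
    using \<epsilon> by real_asymp
  moreover have "\<forall>\<^sub>F s in at_right (0::real). 0 < s \<and> s < 1"
    by (subst eventually_at_right_field) (auto intro!: exI[of _ 1])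
  ultimately have "\<forall>\<^sub>F s in at_right (0::real). 1 < norm p * (1 - s) \<and> norm p * (1 + s) < R \<and>
     norm (p * q - 1) + norm (p * q) * s\<^sup>2 < \<delta> \<and> k * (norm q)\<^sup>2 * s\<^sup>2 < \<epsilon> \<and> 0 < s \<and> s < 1"
    by eventually_elim auto
  \<comment> \<open>The first three conditions keep the circle where \<open>le\<close> applies; the
    fourth makes the mean of the penalty, \<open>k * |p q|^2 * s^4\<close>, smaller than the gain
    \<open>\<epsilon> * |p|^2 * s^2\<close>.\<close>
  then obtain s where s: "1 < norm p * (1 - s)" "norm p * (1 + s) < R"
     "norm (p * q - 1) + norm (p * q) * s\<^sup>2 < \<delta>" "k * (norm q)\<^sup>2 * s\<^sup>2 < \<epsilon>" "0 < s" "s < 1"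
    by (metis (mono_tags, lifting) eventually_happens trivial_limit_at_right_real)
  define A B where "A = p * q - 1" and "B = p * q"
  \<comment> \<open>A holomorphic function with \<open>Re g = \<phi> w1 w2 + m\<close> on the
    circle: \<open>ln |w1|\<close> becomes \<open>Ln\<close>, and the squared moduli are expanded
    using \<open>|\<xi>| = 1\<close> and \<open>w1 * w2 - 1 = A - B * s^2 * \<xi>^2\<close>.\<close>
  define g where "g = (\<lambda>\<xi>. of_real m + of_real (1 + \<eta>) * (of_real (ln (norm p)) + Ln (1 + of_real s * \<xi>))
     + of_real k * (of_real ((norm A)\<^sup>2 + (norm B)\<^sup>2 * s ^ 4) - 2 * of_real (s\<^sup>2) * cnj A * B * \<xi>\<^sup>2)
     - of_real (\<epsilon> * (norm p)\<^sup>2) * (of_real (1 + s\<^sup>2) + 2 * of_real s * \<xi>))"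
  have re_pos: "Re (1 + of_real s * \<xi>) > 0" if "norm \<xi> \<le> 1" for \<xi> :: complex
  proof -
    have "\<bar>s * Re \<xi>\<bar> \<le> s * 1" using s abs_Re_le_cmod[of \<xi>] that
      by (simp only: abs_mult) (intro mult_mono, auto)
    thus ?thesis using s by simp
  qed
  have "u (a + p *s c + q *s c') \<le> ereal (Re (g 0))"
  proof (rule psh_le_harmonic_majorant[OF u, of g _ "(p * of_real s) *s c - (q * of_real s) *s c'"])
    have "1 + of_real s * \<xi> \<notin> \<real>\<^sub>\<le>\<^sub>0" if "\<xi> \<in> cball 0 1" for \<xi> :: complex
      using re_pos[of \<xi>] that by (auto simp: complex_nonpos_Reals_iff)
    thus "g holomorphic_on cball 0 1"
      unfolding g_def by (intro holomorphic_intros) auto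
  next
    fix \<xi> :: complex assume \<xi>: "norm \<xi> = 1"
    define w1 w2 where "w1 = p * (1 + of_real s * \<xi>)" and "w2 = q * (1 - of_real s * \<xi>)"
    have nz: "1 + of_real s * \<xi> \<noteq> 0" using re_pos[of \<xi>] \<xi> by force
    have n1: "norm (1 + of_real s * \<xi>) \<le> 1 + s"
      using norm_triangle_ineq[of 1 "of_real s * \<xi>"] \<xi> s by (simp add: norm_mult)
    have n2: "norm (1 + of_real s * \<xi>) \<ge> 1 - s"
      using norm_triangle_ineq2[of 1 "- (of_real s * \<xi>)"] \<xi> s by (simp add: norm_mult)
    have prod: "w1 * w2 - 1 = A - B * of_real (s\<^sup>2) * \<xi>\<^sup>2"
      by (simp add: w1_def w2_def A_def B_def algebra_simps power2_eq_square)
    have "norm w1 \<ge> norm p * (1 - s)"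
      unfolding w1_def norm_mult by (intro mult_left_mono n2) auto
    hence w1a: "norm w1 \<ge> 1" using s by linarith
    have "norm w1 \<le> norm p * (1 + s)"
      unfolding w1_def norm_mult by (intro mult_left_mono n1) auto
    hence w1b: "norm w1 \<le> R" using s by linarith
    have "norm (w1 * w2 - 1) \<le> norm A + norm (B * of_real (s\<^sup>2) * \<xi>\<^sup>2)"
      unfolding prod by (rule norm_triangle_ineq4)
    also have "\<dots> = norm (p * q - 1) + norm (p * q) * s\<^sup>2"
      using \<xi> by (simp add: A_def B_def norm_mult norm_power)
    finally have w12: "norm (w1 * w2 - 1) \<le> \<delta>" using s by linarith
    have "p \<noteq> 0" using pq by auto
    hence ln1: "ln (norm w1) = ln (norm p) + Re (Ln (1 + of_real s * \<xi>))"
      using nz by (simp add: w1_def norm_mult ln_mult)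
    have sq: "(norm (x + y))\<^sup>2 = (norm x)\<^sup>2 + (norm y)\<^sup>2 + 2 * Re (cnj x * y)" for x y :: complex
      unfolding cmod_power2 by (simp add: power2_eq_square algebra_simps)
    have q1: "(norm w1)\<^sup>2 = (norm p)\<^sup>2 * (1 + s\<^sup>2 + 2 * s * Re \<xi>)"
      unfolding w1_def norm_mult power_mult_distrib sq using \<xi> by (simp add: norm_mult)
    have q2: "(norm (w1 * w2 - 1))\<^sup>2 = (norm A)\<^sup>2 + (norm B)\<^sup>2 * s ^ 4 - Re (2 * of_real (s\<^sup>2) * cnj A * B * \<xi>\<^sup>2)"
    proof -
      have "(norm (w1 * w2 - 1))\<^sup>2 = (norm A)\<^sup>2 + (norm (- (B * of_real (s\<^sup>2) * \<xi>\<^sup>2)))\<^sup>2 + 2 * Re (cnj A * (- (B * of_real (s\<^sup>2) * \<xi>\<^sup>2)))"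
        unfolding prod using sq[of A "- (B * of_real (s\<^sup>2) * \<xi>\<^sup>2)"] by simp
      also have "(norm (- (B * of_real (s\<^sup>2) * \<xi>\<^sup>2)))\<^sup>2 = (norm B)\<^sup>2 * s ^ 4"
        using \<xi> by (simp add: norm_mult norm_power power_mult_distrib flip: power_mult)
      also have "2 * Re (cnj A * (- (B * of_real (s\<^sup>2) * \<xi>\<^sup>2))) = - Re (2 * of_real (s\<^sup>2) * cnj A * B * \<xi>\<^sup>2)"
        by (simp add: algebra_simps)
      finally show ?thesis by simp
    qed
    have Reg: "\<phi> w1 w2 + m = Re (g \<xi>)"
      unfolding \<phi>_def ln1 q1 q2 g_def by simp
    have eq: "a + p *s c + q *s c' + \<xi> *s ((p * of_real s) *s c - (q * of_real s) *s c') = a + w1 *s c + w2 *s c'"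
      by (simp add: vec_eq_iff w1_def w2_def algebra_simps)
    show "u (a + p *s c + q *s c' + \<xi> *s ((p * of_real s) *s c - (q * of_real s) *s c')) \<le> ereal (Re (g \<xi>))"
      using le[OF w1a w1b w12] unfolding eq Reg .
  qed
  also have "Re (g 0) < \<phi> p q + m"
  proof -
    have "k * (norm q)\<^sup>2 * s\<^sup>2 * ((norm p)\<^sup>2 * s\<^sup>2) < \<epsilon> * ((norm p)\<^sup>2 * s\<^sup>2)"
      using s pq by (intro mult_strict_right_mono s(4) mult_pos_pos zero_less_power) auto
    hence "k * ((norm B)\<^sup>2 * s ^ 4) < \<epsilon> * (norm p)\<^sup>2 * s\<^sup>2"
      by (simp add: B_def norm_mult power_mult_distrib mult_ac flip: power_add)
    thus ?thesis by (simp add: g_def \<phi>_def A_def algebra_simps)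
  qed
  hence "ereal (Re (g 0)) < ereal (\<phi> p q + m)" by simp
  finally show ?thesis .
qed


lemma norm_vector_smult: "norm (x *s v) = norm x * norm (v :: complex ^ 'd)"
  by (simp add: norm_vec_def norm_mult L2_set_right_distrib)

lemma logplus_le_ln: "r \<le> s \<Longrightarrow> 1 \<le> s \<Longrightarrow> logplus r \<le> ln s"
  by (auto simp: logplus_def)

text \<open>The ellipse is the image of \<open>w1 * w2 = 1\<close> under the affine map
  \<open>T\<close>. On a compact region \<open>D\<close> around this hyperbola \<open>u o T\<close>
  is compared with \<open>(1 + \<eta>) * ln |w1|\<close> plus penalties;
  \<open>psh_near_hyperbola_no_interior_max\<close> excludes finite interior maxima of the
  difference, so only the three boundary pieces of \<open>D\<close> matter.\<close>

lemma lelong_le_on_ellipse: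
  fixes u :: "complex ^ 'd \<Rightarrow> ereal" and a c c' :: "complex ^ 'd" and r :: real
  assumes u: "lelong u" and r: "1 < r"
    and le0: "\<And>\<zeta>. norm \<zeta> = 1 \<Longrightarrow> u (a + \<zeta> *s c + inverse \<zeta> *s c') \<le> 0"
  shows "u (a + of_real r *s c + of_real (1 / r) *s c') \<le> ereal (ln r)"
proof (rule ereal_le_epsilon2)
  fix e :: real assume e: "e > 0"
  \<comment> \<open>The final error is \<open>\<eta> * ln r\<close> from the enlarged slope plus
    \<open>2 * \<eta>\<close> from the boundary.\<close>
  define \<eta> where "\<eta> = e / (2 + ln r)"
  have lnr: "ln r > 0" using r by simp
  have \<eta>: "\<eta> > 0" "\<eta> * (2 + ln r) = e" using e lnr by (simp_all add: \<eta>_def)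
  have pu: "psh u" using u by (simp add: lelong_def)
  obtain C where C: "\<And>z. u z \<le> ereal (logplus (norm z) + C)" using u by (auto simp: lelong_def)
  define T :: "complex \<times> complex \<Rightarrow> complex ^ 'd" where "T = (\<lambda>w. a + fst w *s c + snd w *s c')"
  define U where "U = (\<lambda>w. u (T w))"
  have Tc: "continuous_on UNIV T"
    unfolding T_def vector_scalar_mult_def by (intro continuous_intros)
  have Uusc: "usc U"
    unfolding usc_def
  proof
    fix t
    have "open (T -` {w. u w < t})"
      using pu Tc by (intro open_vimage) (auto simp: psh_def usc_def)
    thus "open {w. U w < t}" by (simp add: U_def vimage_def)
  qed
  \<comment> \<open>The factor 2 before \<open>norm c'\<close> is the bound for
    \<open>norm w2\<close> on the region.\<close>
  define B where "B = 1 + norm a + norm c + 2 * norm c'"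
  define C1 where "C1 = ln B + \<bar>C\<bar>"
  have B: "B \<ge> 1" by (simp add: B_def)
  hence C1: "C1 \<ge> 0" by (simp add: C1_def)
  have growth: "U (w1, w2) \<le> ereal (ln (norm w1) + C1)"
    if w: "1 \<le> norm w1" "norm (w1 * w2 - 1) \<le> \<delta>" "\<delta> \<le> 1" for w1 w2 \<delta>
  proof -
    have "norm w2 * 1 \<le> norm w2 * norm w1" using w by (intro mult_left_mono) auto
    also have "\<dots> \<le> norm (w1 * w2 - 1) + 1"
      using norm_triangle_ineq[of "w1 * w2 - 1" 1] by (simp add: norm_mult mult.commute)
    finally have w2: "norm w2 \<le> 2" using w by simp
    have "norm (T (w1, w2)) \<le> norm a + norm w1 * norm c + norm w2 * norm c'"
      unfolding T_def using norm_triangle_ineq[of "a + w1 *s c" "w2 *s c'"] norm_triangle_ineq[of a "w1 *s c"]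
      by (simp add: norm_vector_smult)
    also have "\<dots> \<le> norm w1 * norm a + norm w1 * norm c + norm w1 * (2 * norm c')"
    proof -
      have "1 * norm a \<le> norm w1 * norm a" using w by (intro mult_right_mono) auto
      moreover have "norm w2 * norm c' \<le> 2 * norm c'" using w2 by (intro mult_right_mono) auto
      moreover have "1 * (2 * norm c') \<le> norm w1 * (2 * norm c')" using w by (intro mult_right_mono) auto
      ultimately show ?thesis by linarith
    qed
    also have "\<dots> \<le> norm w1 * B" using w by (simp add: B_def algebra_simps)
    finally have "logplus (norm (T (w1, w2))) \<le> ln (norm w1 * B)"
      using w B mult_mono[of 1 "norm w1" 1 B] by (intro logplus_le_ln) auto
    also have "\<dots> = ln (norm w1) + ln B"
      using w B by (subst ln_mult) auto
    finally have "logplus (norm (T (w1, w2))) + C \<le> ln (norm w1) + C1" by (simp add: C1_def)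
    thus ?thesis using C[of "T (w1, w2)"] unfolding U_def by (meson ereal_less_eq(3) order_trans)
  qed
  \<comment> \<open>Outer radius at which the surplus \<open>\<eta> * ln R\<close> absorbs the
    additive growth constant \<open>C1\<close>.\<close>
  define R where "R = max (r + 1) (exp (C1 / \<eta>))"
  have R: "R > r" "R > 1" "C1 \<le> \<eta> * ln R"
  proof -
    have "C1 / \<eta> \<le> ln R" unfolding R_def using r by (subst ln_ge_iff) auto
    thus "C1 \<le> \<eta> * ln R" using \<eta> by (simp add: field_simps)
  qed (use r in \<open>auto simp: R_def\<close>)
  \<comment> \<open>Semicontinuity and compactness spread the bound on the unit circle to a tube,
    which contains the part of \<open>D\<close> with \<open>|w1| = 1\<close>.\<close>
  have "\<exists>\<delta>>0. (\<Union>x\<in>(\<lambda>\<zeta>. (\<zeta>, inverse \<zeta>)) ` sphere 0 1. ball x \<delta>) \<subseteq> {w. U w < ereal \<eta>}"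
  proof (rule compact_subset_open_imp_ball_epsilon_subset)
    show "compact ((\<lambda>\<zeta>::complex. (\<zeta>, inverse \<zeta>)) ` sphere 0 1)"
      by (intro compact_continuous_image continuous_intros) auto
    show "open {w. U w < ereal \<eta>}" using Uusc by (simp add: usc_def)
    have "U (\<zeta>, inverse \<zeta>) < ereal \<eta>" if "norm \<zeta> = 1" for \<zeta>
      using le0[OF that] \<eta> unfolding U_def T_def by (simp add: order_le_less_trans)
    thus "(\<lambda>\<zeta>. (\<zeta>, inverse \<zeta>)) ` sphere 0 1 \<subseteq> {w. U w < ereal \<eta>}" by auto
  qed auto
  then obtain \<delta>' where \<delta>': "\<delta>' > 0" "\<And>\<zeta> w. norm \<zeta> = 1 \<Longrightarrow> w \<in> ball (\<zeta>, inverse \<zeta>) \<delta>' \<Longrightarrow> U w < ereal \<eta>"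
    by fastforce
  define \<delta> where "\<delta> = min 1 (\<delta>' / 2)"
  have \<delta>: "\<delta> > 0" "\<delta> \<le> 1" "\<delta> < \<delta>'" using \<delta>' by (auto simp: \<delta>_def)
  have circ: "U (w1, w2) \<le> ereal \<eta>" if w: "norm w1 = 1" "norm (w1 * w2 - 1) \<le> \<delta>" for w1 w2
  proof -
    have "w1 * w2 - 1 = w1 * (w2 - inverse w1)" using w by (auto simp: field_simps)
    hence "norm (w2 - inverse w1) \<le> \<delta>" using w by (simp add: norm_mult)
    hence "(w1, w2) \<in> ball (w1, inverse w1) \<delta>'"
      using \<delta> by (simp add: dist_Pair_Pair dist_norm norm_minus_commute)
    thus ?thesis using \<delta>'(2) w(1) less_imp_le by blast
  qed
  \<comment> \<open>On \<open>|w1 * w2 - 1| = \<delta>\<close> the penalty equals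
    \<open>ln R + C1\<close>, the largest value that the growth bound allows;
    \<open>\<epsilon>\<close> is chosen so that its term costs at most \<open>\<eta>\<close> on
    \<open>D\<close>.\<close>
  define k where "k = (ln R + C1) / \<delta>\<^sup>2"
  define \<epsilon> where "\<epsilon> = \<eta> / R\<^sup>2"
  have \<epsilon>: "\<epsilon> > 0" "\<epsilon> * R\<^sup>2 = \<eta>" using \<eta> R by (auto simp: \<epsilon>_def)
  have k: "k \<ge> 0" "k * \<delta>\<^sup>2 = ln R + C1" using R C1 \<delta> by (auto simp: k_def)
  \<comment> \<open>The \<open>max 1\<close> changes nothing on \<open>D\<close> and makes the
    function continuous everywhere.\<close>
  define \<psi> where "\<psi> = (\<lambda>w::complex\<times>complex. (1 + \<eta>) * ln (max 1 (norm (fst w)))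
      + k * (norm (fst w * snd w - 1))\<^sup>2 - \<epsilon> * (norm (fst w))\<^sup>2)"
  define D where "D = {w::complex\<times>complex. 1 \<le> norm (fst w) \<and> norm (fst w) \<le> R \<and> norm (fst w * snd w - 1) \<le> \<delta>}"
  have \<psi>c: "continuous_on UNIV \<psi>"
    unfolding \<psi>_def by (intro continuous_intros) auto
  have "closed D" unfolding D_def
    by (intro closed_Collect_conj closed_Collect_le continuous_intros)
  moreover have "bounded D"
  proof -
    have "norm w \<le> R + 2" if "w \<in> D" for w
    proof -
      obtain w1 w2 where w: "w = (w1, w2)" by (cases w)
      have "norm w2 * 1 \<le> norm w2 * norm w1" using that by (intro mult_left_mono) (auto simp: w D_def)
      also have "\<dots> \<le> norm (w1 * w2 - 1) + 1"
        using norm_triangle_ineq[of "w1 * w2 - 1" 1] by (simp add: norm_mult mult.commute)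
      finally have "norm w2 \<le> 2" using that \<delta> by (simp add: w D_def)
      thus ?thesis using norm_Pair_le[of w1 w2] that by (simp add: w D_def)
    qed
    thus ?thesis unfolding bounded_iff by blast
  qed
  ultimately have "compact D" by (simp add: compact_eq_bounded_closed)
  moreover have rD: "(of_real r, of_real (1 / r)) \<in> D" using r R \<delta> by (simp add: D_def)
  ultimately have "\<exists>x\<in>D. \<forall>y\<in>D. U y - ereal (\<psi> y) \<le> U x - ereal (\<psi> x)"
    by (intro usc_minus_continuous_attains_sup Uusc \<psi>c) auto
  then obtain p q where pq: "(p, q) \<in> D" "\<And>y. y \<in> D \<Longrightarrow> U y - ereal (\<psi> y) \<le> U (p, q) - ereal (\<psi> (p, q))"
    by auto
  \<comment> \<open>On \<open>|w1| = 1\<close> one \<open>\<eta>\<close> comes from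
    \<open>circ\<close> and one from the term with \<open>\<epsilon>\<close>; the two other boundary
    pieces give at most \<open>\<eta>\<close>.\<close>
  have max_le: "U (p, q) - ereal (\<psi> (p, q)) \<le> ereal (2 * \<eta>)"
  proof (rule ccontr)
    assume neg: "\<not> ?thesis"
    have "U (p, q) \<noteq> \<infinity>" using pu by (simp add: U_def psh_def)
    then obtain m where m: "U (p, q) = ereal (\<psi> (p, q) + m)" "m > 2 * \<eta>"
      using neg by (cases "U (p, q)") (auto intro: that[of "real_of_ereal (U (p,q)) - \<psi> (p,q)"])
    have pD: "1 \<le> norm p" "norm p \<le> R" "norm (p * q - 1) \<le> \<delta>" using pq(1) by (auto simp: D_def)
    have sqle: "\<epsilon> * (norm p)\<^sup>2 \<le> \<eta>"
      using \<epsilon> pD by (subst \<epsilon>(2)[symmetric], intro mult_left_mono power_mono) auto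
    have "0 < norm p" using pD by linarith
    hence lnp: "0 \<le> ln (norm p)" "ln (norm p) \<le> ln R" using pD by (simp_all add: ln_le_cancel_iff del: zero_less_norm_iff)
    have kp: "0 \<le> k * (norm (p * q - 1))\<^sup>2" using k by simp
    have \<psi>pq: "\<psi> (p, q) = (1 + \<eta>) * ln (norm p) + k * (norm (p * q - 1))\<^sup>2 - \<epsilon> * (norm p)\<^sup>2"
      using pD by (simp add: \<psi>_def max_def)
    have Upq: "ereal (\<psi> (p, q) + m) \<le> ereal (ln (norm p) + C1)"
      using growth[of p q \<delta>] pD \<delta> m by simp
    have "norm p \<noteq> 1"
    proof
      assume "norm p = 1"
      hence "\<psi> (p, q) + m \<le> \<eta>" using circ[of p q] pD m by simp
      moreover have "\<psi> (p, q) \<ge> - \<eta>" using \<psi>pq sqle kp \<open>norm p = 1\<close> by simp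
      ultimately show False using m by simp
    qed
    moreover have "norm p \<noteq> R"
    proof
      assume "norm p = R"
      hence "\<psi> (p, q) \<ge> ln R + C1 - \<eta>" using \<psi>pq sqle kp R by (simp add: algebra_simps)
      thus False using m \<eta> Upq \<open>norm p = R\<close> by simp
    qed
    moreover have "norm (p * q - 1) \<noteq> \<delta>"
    proof
      assume *: "norm (p * q - 1) = \<delta>"
      have "0 \<le> (1 + \<eta>) * ln (norm p)" using lnp \<eta> by simp
      hence "\<psi> (p, q) \<ge> ln R + C1 - \<eta>" using \<psi>pq sqle k * by simp
      thus False using m \<eta> Upq lnp by simp
    qed
    ultimately have "1 < norm p" "norm p < R" "norm (p * q - 1) < \<delta>" using pD by auto
    hence "u (a + p *s c + q *s c') < ereal ((1 + \<eta>) * ln (norm p) + k * (norm (p * q - 1))\<^sup>2 - \<epsilon> * (norm p)\<^sup>2 + m)"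
    proof (rule psh_near_hyperbola_no_interior_max[OF pu])
      fix w1 w2 :: complex assume w: "1 \<le> norm w1" "norm w1 \<le> R" "norm (w1 * w2 - 1) \<le> \<delta>"
      hence "U (w1, w2) - ereal (\<psi> (w1, w2)) \<le> U (p, q) - ereal (\<psi> (p, q))" by (intro pq) (auto simp: D_def)
      also have "\<dots> = ereal m" using m by simp
      finally have "U (w1, w2) \<le> ereal (\<psi> (w1, w2) + m)" by (cases "U (w1, w2)") auto
      thus "u (a + w1 *s c + w2 *s c') \<le> ereal ((1 + \<eta>) * ln (norm w1) + k * (norm (w1 * w2 - 1))\<^sup>2
                - \<epsilon> * (norm w1)\<^sup>2 + m)"
        using w by (simp add: U_def T_def \<psi>_def max_def)
    qed (use \<epsilon> k in auto)
    thus False using m(1) \<psi>pq by (simp add: U_def T_def)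
  qed
  have "U (of_real r, of_real (1 / r)) - ereal (\<psi> (of_real r, of_real (1 / r))) \<le> ereal (2 * \<eta>)"
    using pq(2)[OF rD] max_le by (rule order_trans)
  moreover have "\<psi> (of_real r, of_real (1 / r)) \<le> (1 + \<eta>) * ln r"
    using r \<epsilon> by (simp add: \<psi>_def max_def)
  ultimately have "U (of_real r, of_real (1 / r)) \<le> ereal ((1 + \<eta>) * ln r + 2 * \<eta>)"
    by (cases "U (of_real r, of_real (1 / r))") auto
  also have "(1 + \<eta>) * ln r + 2 * \<eta> = ln r + e"
    using \<eta>(2) by (simp add: algebra_simps)
  finally show "u (a + of_real r *s c + of_real (1 / r) *s c') \<le> ereal (ln r) + ereal e"
    by (simp add: U_def T_def)
qed

section \<open>The extremal candidate of a simplex\<close>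

text \<open>With \<open>\<sigma>\<close> the square root,
  \<open>(\<zeta> + \<sigma>) * (\<zeta> - \<sigma>) = 1\<close>, so the squared moduli of the
  factors are \<open>j\<close> and \<open>1 / j\<close>; their sum is given by the parallelogram
  law.\<close>

lemma norm_joukowski_inverse:
  fixes \<zeta> :: complex
  defines "j \<equiv> (norm (\<zeta> + csqrt (\<zeta>\<^sup>2 - 1)))\<^sup>2"
  shows "0 < j" "cosh (ln j) = (norm \<zeta>)\<^sup>2 + norm (\<zeta>\<^sup>2 - 1)"
proof -
  define \<sigma> where "\<sigma> = csqrt (\<zeta>\<^sup>2 - 1)"
  have \<sigma>: "\<sigma>\<^sup>2 = \<zeta>\<^sup>2 - 1" by (simp add: \<sigma>_def)
  have "(\<zeta> + \<sigma>) * (\<zeta> - \<sigma>) = \<zeta>\<^sup>2 - \<sigma>\<^sup>2" by (simp add: algebra_simps power2_eq_square)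
  hence "norm (\<zeta> + \<sigma>) * norm (\<zeta> - \<sigma>) = 1" by (simp add: \<sigma> flip: norm_mult)
  hence prod: "j * (norm (\<zeta> - \<sigma>))\<^sup>2 = 1"
    by (simp add: j_def \<sigma>_def[symmetric] flip: power_mult_distrib)
  hence "j \<noteq> 0" by auto
  thus j: "0 < j" by (simp add: j_def)
  have "j + (norm (\<zeta> - \<sigma>))\<^sup>2 = 2 * (norm \<zeta>)\<^sup>2 + 2 * (norm \<sigma>)\<^sup>2"
    unfolding j_def \<sigma>_def[symmetric] cmod_power2 by (simp add: power2_eq_square algebra_simps)
  moreover have "(norm \<sigma>)\<^sup>2 = norm (\<zeta>\<^sup>2 - 1)" using \<sigma> by (metis norm_power)
  moreover have "(norm (\<zeta> - \<sigma>))\<^sup>2 = inverse j" by (rule inverse_unique[OF prod, symmetric])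
  ultimately show "cosh (ln j) = (norm \<zeta>)\<^sup>2 + norm (\<zeta>\<^sup>2 - 1)"
    using j by (simp add: cosh_ln_real)
qed

text \<open>The branch of \<open>csqrt\<close> may give \<open>j < 1\<close>; \<open>cosh\<close>
  sees only \<open>|ln j|\<close>, hence an inequality.\<close>

lemma norm_joukowski_inverse_le:
  fixes \<zeta> :: complex
  assumes "(norm \<zeta>)\<^sup>2 + norm (\<zeta>\<^sup>2 - 1) \<le> Y"
  shows "(norm (\<zeta> + csqrt (\<zeta>\<^sup>2 - 1)))\<^sup>2 \<le> exp (arcosh Y)"
proof -
  define j where "j = (norm (\<zeta> + csqrt (\<zeta>\<^sup>2 - 1)))\<^sup>2"
  have j: "0 < j" "cosh (ln j) \<le> Y"
    using norm_joukowski_inverse[of \<zeta>] assms by (simp_all add: j_def)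
  have "ln j \<le> \<bar>ln j\<bar>" by simp
  also have "\<dots> = arcosh (cosh \<bar>ln j\<bar>)" by (rule arcosh_cosh_real[symmetric]) simp
  also have "\<dots> \<le> arcosh Y"
    using j cosh_real_ge_1[of "ln j"] arcosh_less_iff_real[of Y "cosh (ln j)"] by (auto simp: not_less[symmetric])
  finally have "exp (ln j) \<le> exp (arcosh Y)" by simp
  thus ?thesis using j unfolding j_def[symmetric] by (simp only: exp_ln)
qed

text \<open>Write \<open>s = E * e + r\<close> with \<open>r\<close> orthogonal to \<open>e\<close>.
  As \<open>e\<close> is real, this holds for the bilinear and for the Hermitian product: the first
  gives \<open>1 - E^2\<close> as the sum of the \<open>(r i)^2\<close>, the second splits the sum
  of the \<open>|s i|^2\<close>.\<close>

lemma norm_inner_unit_joukowski: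
  fixes s :: "'i \<Rightarrow> complex" and e :: "'i \<Rightarrow> real"
  assumes s: "(\<Sum>i\<in>J. (s i)\<^sup>2) = 1" and e: "(\<Sum>i\<in>J. (e i)\<^sup>2) = 1"
  defines "E \<equiv> \<Sum>i\<in>J. of_real (e i) * s i"
  shows "(norm E)\<^sup>2 + norm (E\<^sup>2 - 1) \<le> (\<Sum>i\<in>J. (norm (s i))\<^sup>2)"
proof -
  define r where "r = (\<lambda>i. s i - E * of_real (e i))"
  have "(\<Sum>i\<in>J. (complex_of_real (e i))\<^sup>2) = of_real (\<Sum>i\<in>J. (e i)\<^sup>2)" by simp
  hence e': "(\<Sum>i\<in>J. (complex_of_real (e i))\<^sup>2) = 1" unfolding e by simp
  have er: "(\<Sum>i\<in>J. of_real (e i) * r i) = 0"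
  proof -
    have "(\<Sum>i\<in>J. of_real (e i) * r i)
        = (\<Sum>i\<in>J. of_real (e i) * s i) - (\<Sum>i\<in>J. E * (complex_of_real (e i))\<^sup>2)"
      unfolding sum_subtractf[symmetric]
      by (intro sum.cong) (auto simp: r_def algebra_simps power2_eq_square)
    also have "\<dots> = E - E * (\<Sum>i\<in>J. (complex_of_real (e i))\<^sup>2)"
      by (simp only: E_def[symmetric] sum_distrib_left)
    finally show ?thesis using e' by simp
  qed
  have "(\<Sum>i\<in>J. (s i)\<^sup>2) = (\<Sum>i\<in>J. (r i)\<^sup>2) + 2 * E * (\<Sum>i\<in>J. of_real (e i) * r i)
            + E\<^sup>2 * (\<Sum>i\<in>J. (complex_of_real (e i))\<^sup>2)"
    unfolding sum_distrib_left sum.distrib[symmetric]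
    by (intro sum.cong) (auto simp: r_def power2_eq_square algebra_simps)
  hence "E\<^sup>2 - 1 = - (\<Sum>i\<in>J. (r i)\<^sup>2)" using s e' er by (simp add: algebra_simps)
  hence "norm (E\<^sup>2 - 1) \<le> (\<Sum>i\<in>J. (norm (r i))\<^sup>2)"
    using norm_sum[of "\<lambda>i. (r i)\<^sup>2" J] by (simp add: norm_power)
  moreover have "(\<Sum>i\<in>J. (norm (s i))\<^sup>2) = (\<Sum>i\<in>J. (norm (r i))\<^sup>2) + (norm E)\<^sup>2"
  proof -
    have "(norm (s i))\<^sup>2 = (norm (r i))\<^sup>2 + 2 * Re (cnj E * (of_real (e i) * r i)) + (norm E)\<^sup>2 * (e i)\<^sup>2" for i
      unfolding r_def cmod_power2 by (simp add: power2_eq_square algebra_simps)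
    hence "(\<Sum>i\<in>J. (norm (s i))\<^sup>2) = (\<Sum>i\<in>J. (norm (r i))\<^sup>2)
        + 2 * Re (cnj E * (\<Sum>i\<in>J. of_real (e i) * r i)) + (norm E)\<^sup>2 * (\<Sum>i\<in>J. (e i)\<^sup>2)"
      by (simp only: sum.distrib sum_distrib_left Re_sum)
    thus ?thesis using er e by simp
  qed
  ultimately show ?thesis by simp
qed

text \<open>Locally each \<open>w i\<close> has a holomorphic square root \<open>s i\<close> unless \<open>w i\<close> vanishes at the point, in
  which case the coefficient \<open>e i\<close> vanishes too. For a real unit vector \<open>e\<close> the square of the inverse
  Joukowski image of \<open>\<Sum> e i * s i\<close> is then a holomorphic minorant, sharp when \<open>e\<close> is parallel to the
  real part of \<open>s\<close>.\<close>

lemma arcosh_sum_norm_local_support: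
  fixes w :: "'i \<Rightarrow> complex \<Rightarrow> complex"
  assumes J: "finite J" and hol: "\<And>i. i \<in> J \<Longrightarrow> w i holomorphic_on UNIV"
    and sum1: "\<And>y. (\<Sum>i\<in>J. w i y) = 1"
  defines "G \<equiv> \<lambda>y. arcosh (\<Sum>i\<in>J. norm (w i y))"
  shows "\<exists>F. \<exists>\<rho>>0. F holomorphic_on ball x \<rho> \<and> norm (F x) = exp (G x)
                 \<and> (\<forall>y\<in>ball x \<rho>. norm (F y) \<le> exp (G y))"
proof -
  have ge1: "1 \<le> (\<Sum>i\<in>J. norm (w i y))" for y
    using norm_sum[of "\<lambda>i. w i y" J] sum1[of y] by simp
  define X where "X = (\<Sum>i\<in>J. norm (w i x))"
  show ?thesis
  proof (cases "X = 1")
    case True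
    show ?thesis
      \<comment> \<open>Here \<open>G x = 0\<close> is the minimum of \<open>G\<close>, so a
        constant is a support.\<close>
      by (rule exI[of _ "\<lambda>_. 1"], rule exI[of _ 1]) (use True ge1 in \<open>auto simp: G_def X_def\<close>)
  next
    case False
    hence X: "X > 1" using ge1[of x] by (simp add: X_def)
    \<comment> \<open>The length of the real part of \<open>\<sigma>\<close>: its square is half the
      sum of \<open>|w i x| + Re (w i x)\<close>, and the real parts sum to 1.\<close>
    define P where "P = sqrt ((X + 1) / 2)"
    have P: "P\<^sup>2 = (X + 1) / 2" "P > 1" using X by (auto simp: P_def)
    define \<sigma> where "\<sigma> = (\<lambda>i. csqrt (w i x))"
    \<comment> \<open>Dividing by \<open>w i x\<close> places the radicand near 1, away from the
      branch cut.\<close>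
    define s where "s = (\<lambda>i y. if w i x = 0 then csqrt (w i y) else \<sigma> i * csqrt (w i y / w i x))"
    define e where "e = (\<lambda>i. Re (\<sigma> i) / P)"
    have s2: "(s i y)\<^sup>2 = w i y" for i y
      by (auto simp: s_def \<sigma>_def power_mult_distrib)
    have sx: "s i x = \<sigma> i" for i by (auto simp: s_def \<sigma>_def)
    have \<sigma>2: "(Re (\<sigma> i))\<^sup>2 = (norm (w i x) + Re (w i x)) / 2" "2 * (Re (\<sigma> i) * Im (\<sigma> i)) = Im (w i x)" for i
    proof -
      have *: "(\<sigma> i)\<^sup>2 = w i x" by (simp add: \<sigma>_def)
      have "(norm (\<sigma> i))\<^sup>2 = norm (w i x)" by (metis * norm_power)
      hence "(Re (\<sigma> i))\<^sup>2 + (Im (\<sigma> i))\<^sup>2 = norm (w i x)" by (simp add: cmod_power2)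
      moreover have "(Re (\<sigma> i))\<^sup>2 - (Im (\<sigma> i))\<^sup>2 = Re (w i x)" by (metis * Re_power2)
      ultimately show "(Re (\<sigma> i))\<^sup>2 = (norm (w i x) + Re (w i x)) / 2" by simp
      show "2 * (Re (\<sigma> i) * Im (\<sigma> i)) = Im (w i x)" using Im_power2[of "\<sigma> i"] * by simp
    qed
    have sumRe: "(\<Sum>i\<in>J. (Re (\<sigma> i))\<^sup>2) = P\<^sup>2"
    proof -
      have "(\<Sum>i\<in>J. Re (w i x)) = 1" using sum1[of x] by (metis Re_sum one_complex.sel(1))
      thus ?thesis unfolding \<sigma>2 by (simp add: P X_def sum.distrib flip: sum_divide_distrib)
    qed
    have e1: "(\<Sum>i\<in>J. (e i)\<^sup>2) = 1"
      using sumRe P by (simp add: e_def power_divide flip: sum_divide_distrib)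
    define E where "E = (\<lambda>y. \<Sum>i\<in>J. of_real (e i) * s i y)"
    \<comment> \<open>The imaginary part is a multiple of the sum of the \<open>Im (w i x)\<close>,
      which vanishes.\<close>
    have Ex: "E x = of_real P"
    proof -
      have "E x = of_real (\<Sum>i\<in>J. (Re (\<sigma> i))\<^sup>2 / P) + \<i> * of_real ((\<Sum>i\<in>J. 2 * (Re (\<sigma> i) * Im (\<sigma> i))) / (2 * P))"
        unfolding E_def sx e_def
        by (simp add: complex_eq_iff power2_eq_square sum_divide_distrib)
      also have "(\<Sum>i\<in>J. (Re (\<sigma> i))\<^sup>2 / P) = P"
        using sumRe P by (simp add: power2_eq_square flip: sum_divide_distrib)
      also have "(\<Sum>i\<in>J. 2 * (Re (\<sigma> i) * Im (\<sigma> i))) = 0"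
        unfolding \<sigma>2 using sum1[of x] by (metis Im_sum one_complex.sel(2))
      finally show ?thesis by simp
    qed
    define V1 where "V1 = (\<Inter>i\<in>{i\<in>J. w i x \<noteq> 0}. {y. 0 < Re (w i y / w i x)})"
    have wc: "continuous_on UNIV (w i)" if "i \<in> J" for i
      using hol[OF that] by (rule holomorphic_on_imp_continuous_on)
    have "open V1" unfolding V1_def
      by (intro open_INT ballI open_Collect_less continuous_intros wc) (use J in auto)
    have Ehol: "E holomorphic_on V1"
      unfolding E_def
    proof (intro holomorphic_on_sum)
      fix i assume i: "i \<in> J"
      show "(\<lambda>y. of_real (e i) * s i y) holomorphic_on V1"
      proof (cases "w i x = 0")
        case True
        hence "e i = 0" by (simp add: e_def \<sigma>_def)
        thus ?thesis by simp
      next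
        case False
        have "w i y / w i x \<notin> \<real>\<^sub>\<le>\<^sub>0" if "y \<in> V1" for y
          using that i False by (auto simp: V1_def complex_nonpos_Reals_iff)
        moreover have "w i holomorphic_on V1" using hol[OF i] by (rule holomorphic_on_subset) auto
        ultimately have "(\<lambda>y. of_real (e i) * (\<sigma> i * csqrt (w i y / w i x))) holomorphic_on V1"
          using False by (intro holomorphic_intros) auto
        thus ?thesis using False by (simp add: s_def)
      qed
    qed
    \<comment> \<open>\<open>E^2 - 1\<close> is the positive number \<open>P^2 - 1\<close> at
      \<open>x\<close>, so the outer square root is holomorphic nearby.\<close>
    define V2 where "V2 = V1 \<inter> (\<lambda>y. Re ((E y)\<^sup>2 - 1)) -` {0<..}"
    have "open V2" unfolding V2_def
      by (intro continuous_open_preimage continuous_intros holomorphic_on_imp_continuous_on Ehol \<open>open V1\<close>) auto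
    moreover have "x \<in> V2"
      using P X by (auto simp: V2_def V1_def Ex simp flip: of_real_power)
    ultimately obtain \<rho> where \<rho>: "\<rho> > 0" "ball x \<rho> \<subseteq> V2" using openE by blast
    define F where "F = (\<lambda>y. (E y + csqrt ((E y)\<^sup>2 - 1))\<^sup>2)"
    have "F holomorphic_on V2"
      unfolding F_def V2_def
      by (intro holomorphic_intros holomorphic_on_subset[OF Ehol]) (auto simp: complex_nonpos_Reals_iff)
    hence "F holomorphic_on ball x \<rho>" using \<rho>(2) by (rule holomorphic_on_subset)
    moreover have le: "norm (F y) \<le> exp (G y)" for y
    proof -
      have "(norm (s i y))\<^sup>2 = norm (w i y)" for i by (metis s2 norm_power)
      hence "(norm (E y))\<^sup>2 + norm ((E y)\<^sup>2 - 1) \<le> (\<Sum>i\<in>J. norm (w i y))"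
        using norm_inner_unit_joukowski[of "\<lambda>i. s i y" J e] e1 s2 sum1 by (simp add: E_def)
      from norm_joukowski_inverse_le[OF this] show ?thesis
        by (simp add: F_def G_def norm_power)
    qed
    moreover have "norm (F x) = exp (G x)"
    proof -
      have 1: "0 < P\<^sup>2 - 1" using X P by simp
      have Ex1: "(E x)\<^sup>2 - 1 = of_real (P\<^sup>2 - 1)" by (simp add: Ex)
      have "norm ((E x)\<^sup>2 - 1) = P\<^sup>2 - 1" unfolding Ex1 norm_of_real using 1 by simp
      moreover have "norm (E x) = P" using P by (simp add: Ex)
      ultimately have "cosh (ln (norm (F x))) = P\<^sup>2 + (P\<^sup>2 - 1)"
        using norm_joukowski_inverse(2)[of "E x"] by (simp only: F_def norm_power)
      also have "\<dots> = X" using P by simp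
      finally have c: "cosh (ln (norm (F x))) = X" .
      have "norm (E x + csqrt ((E x)\<^sup>2 - 1)) = P + sqrt (P\<^sup>2 - 1)"
      proof -
        have "E x + csqrt ((E x)\<^sup>2 - 1) = of_real (P + sqrt (P\<^sup>2 - 1))"
          unfolding Ex1 using 1 Ex by (subst of_real_sqrt[symmetric]) auto
        thus ?thesis using P 1 by (simp only: norm_of_real) simp
      qed
      hence "norm (F x) = (P + sqrt (P\<^sup>2 - 1))\<^sup>2" by (simp only: F_def norm_power)
      hence "norm (F x) \<ge> 1"
        using P(2) 1 by (metis add_increasing2 less_imp_le one_le_power real_sqrt_ge_zero)
      hence "ln (norm (F x)) = arcosh X" using c by (metis arcosh_cosh_real ln_ge_zero)
      thus ?thesis using \<open>norm (F x) \<ge> 1\<close> by (metis G_def X_def exp_ln less_le_trans zero_less_one)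
    qed
    ultimately show ?thesis using \<rho>(1) by blast
  qed
qed

text \<open>The complexification of a real affine function, without conjugation, hence holomorphic
  in \<open>z\<close>.\<close>

definition caffine :: "real \<Rightarrow> real ^ 'd \<Rightarrow> complex ^ 'd \<Rightarrow> complex" where
  "caffine b a z = of_real b + (\<Sum>k\<in>UNIV. of_real (a $ k) * z $ k)"

lemma caffine_cvec: "caffine b a (cvec x) = of_real (b + a \<bullet> x)"
  by (simp add: caffine_def cvec_def inner_vec_def)

lemma norm_caffine_le: "norm (caffine b a z) \<le> \<bar>b\<bar> + (\<Sum>k\<in>UNIV. \<bar>a $ k\<bar>) * norm z"
proof -
  have "norm (\<Sum>k\<in>UNIV. of_real (a $ k) * z $ k) \<le> (\<Sum>k\<in>UNIV. \<bar>a $ k\<bar> * norm z)"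
    by (intro order_trans[OF norm_sum] sum_mono)
       (auto simp: norm_mult intro!: mult_left_mono Finite_Cartesian_Product.norm_nth_le)
  thus ?thesis
    unfolding caffine_def sum_distrib_right
    by (intro order_trans[OF norm_triangle_ineq] add_mono) auto
qed

lemma sum_caffine:
  assumes "(\<Sum>i\<in>J. b i) = 1" "(\<Sum>i\<in>J. a i) = 0"
  shows "(\<Sum>i\<in>J. caffine (b i) (a i) z) = 1"
proof -
  have "(\<Sum>i\<in>J. caffine (b i) (a i) z) = of_real (\<Sum>i\<in>J. b i) + (\<Sum>k\<in>UNIV. of_real ((\<Sum>i\<in>J. a i) $ k) * z $ k)"
    unfolding caffine_def sum.distrib by (subst sum.swap) (simp add: sum_distrib_right)
  thus ?thesis using assms by simp
qed

text \<open>The two sum conditions make the affine functions sum to 1 on all of complex space, so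
  the local supports exist on every complex line. Growth of slope 1 follows from
  \<open>arcosh Y \<le> ln (2 * Y)\<close> and linear growth of \<open>Y\<close>.\<close>

lemma lelong_arcosh_barycentric:
  fixes a :: "'i \<Rightarrow> real ^ 'd"
  assumes J: "finite J" and b: "(\<Sum>i\<in>J. b i) = 1" and a: "(\<Sum>i\<in>J. a i) = 0"
  shows "lelong (\<lambda>z. ereal (arcosh (\<Sum>i\<in>J. norm (caffine (b i) (a i) z))))"
proof -
  define Y where "Y = (\<lambda>z. \<Sum>i\<in>J. norm (caffine (b i) (a i) z))"
  have Y1: "Y z \<ge> 1" for z
    using norm_sum[of "\<lambda>i. caffine (b i) (a i) z" J] sum_caffine[OF b a, of z] by (simp add: Y_def)
  have "continuous_on UNIV Y" unfolding Y_def caffine_def by (intro continuous_intros)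
  hence Yc: "continuous_on UNIV (\<lambda>z. arcosh (Y z))"
    by (rule continuous_on_compose2[OF continuous_on_arcosh[OF order.refl]]) (use Y1 in auto)
  have "psh (\<lambda>z. ereal (arcosh (Y z)))"
  proof (rule psh_ereal_of_continuous[OF Yc])
    fix p q :: "complex ^ 'd"
    define w where "w = (\<lambda>i \<xi>. caffine (b i) (a i) (p + \<xi> *s q))"
    define G where "G = (\<lambda>\<xi>. arcosh (\<Sum>i\<in>J. norm (w i \<xi>)))"
    have GY: "G \<xi> = arcosh (Y (p + \<xi> *s q))" for \<xi> by (simp add: G_def w_def Y_def)
    have "2 * pi * G 0 \<le> integral {0..2*pi} (\<lambda>\<theta>. G (cis \<theta>))"
    proof (rule submean_of_local_support)
      show "continuous_on UNIV G"
        unfolding GY vector_scalar_mult_def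
        by (rule continuous_on_compose2[OF Yc]) (auto intro!: continuous_intros)
      show "\<exists>F. \<exists>\<rho>>0. F holomorphic_on ball x \<rho> \<and> norm (F x) = exp (G x)
                 \<and> (\<forall>y\<in>ball x \<rho>. norm (F y) \<le> exp (G y))" for x
        unfolding G_def
        by (rule arcosh_sum_norm_local_support[OF J])
           (auto simp: w_def sum_caffine[OF b a], auto simp: caffine_def intro!: holomorphic_intros)
    qed
    thus "2 * pi * arcosh (Y p) \<le> integral {0..2*pi} (\<lambda>\<theta>. arcosh (Y (p + cis \<theta> *s q)))"
      by (simp add: GY)
  qed
  moreover have "\<exists>C. \<forall>z. ereal (arcosh (Y z)) \<le> ereal (logplus (norm z) + C)"
  proof -
    define B where "B = 1 + (\<Sum>i\<in>J. \<bar>b i\<bar> + (\<Sum>k\<in>UNIV. \<bar>a i $ k\<bar>))"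
    have B: "B \<ge> 1" unfolding B_def by (auto intro!: sum_nonneg add_nonneg_nonneg)
    have "arcosh (Y z) \<le> logplus (norm z) + ln (2 * B)" for z
    proof -
      define m where "m = max 1 (norm z)"
      have m: "m \<ge> 1" "norm z \<le> m" by (auto simp: m_def)
      have "Y z \<le> (\<Sum>i\<in>J. \<bar>b i\<bar> + (\<Sum>k\<in>UNIV. \<bar>a i $ k\<bar>) * norm z)"
        unfolding Y_def by (intro sum_mono norm_caffine_le)
      also have "\<dots> \<le> (\<Sum>i\<in>J. (\<bar>b i\<bar> + (\<Sum>k\<in>UNIV. \<bar>a i $ k\<bar>)) * m)"
      proof (rule sum_mono)
        fix i
        have "\<bar>b i\<bar> * 1 \<le> \<bar>b i\<bar> * m" using m by (intro mult_left_mono) auto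
        moreover have "(\<Sum>k\<in>UNIV. \<bar>a i $ k\<bar>) * norm z \<le> (\<Sum>k\<in>UNIV. \<bar>a i $ k\<bar>) * m"
          using m by (intro mult_left_mono sum_nonneg) auto
        ultimately show "\<bar>b i\<bar> + (\<Sum>k\<in>UNIV. \<bar>a i $ k\<bar>) * norm z \<le> (\<bar>b i\<bar> + (\<Sum>k\<in>UNIV. \<bar>a i $ k\<bar>)) * m"
          by (simp add: algebra_simps)
      qed
      also have "\<dots> = (B - 1) * m" by (simp only: B_def sum_distrib_right add_diff_cancel_left')
      also have "\<dots> \<le> B * m" using m by (simp add: algebra_simps)
      finally have YB: "Y z \<le> B * m" .
      have "sqrt ((Y z)\<^sup>2 - 1) \<le> Y z" using Y1[of z] by (intro real_le_lsqrt) auto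
      hence "arcosh (Y z) \<le> ln (2 * Y z)"
        using Y1[of z] by (subst arcosh_real_def) (auto intro!: ln_mono add_pos_nonneg)
      also have "\<dots> \<le> ln ((2 * B) * m)" using YB Y1[of z] by (intro ln_mono) auto
      also have "\<dots> = ln (2 * B) + ln m" using B m by (subst ln_mult) auto
      also have "ln m = logplus (norm z)" by (auto simp: m_def logplus_def max_def)
      finally show ?thesis by simp
    qed
    thus ?thesis by auto
  qed
  ultimately show ?thesis by (simp add: lelong_def Y_def)
qed

section \<open>Farkas certificates of minimal support\<close>

text \<open>The cone generated by \<open>(0, 1)\<close> and the \<open>(a i, d i)\<close> is closed.
  If it missed \<open>(0, -1)\<close>, a separating functional \<open>(y, \<tau>)\<close> would have
  \<open>\<tau> > 0\<close>, and \<open>- y / \<tau>\<close> would solve the system.\<close>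

lemma farkas_inconsistent_system:
  fixes a :: "'i \<Rightarrow> 'a::euclidean_space" and d :: "'i \<Rightarrow> real"
  assumes I: "finite I" and inc: "\<nexists>x. \<forall>i\<in>I. a i \<bullet> x \<le> d i"
  shows "\<exists>\<mu>. (\<forall>i\<in>I. 0 \<le> \<mu> i) \<and> (\<Sum>i\<in>I. \<mu> i *\<^sub>R a i) = 0 \<and> (\<Sum>i\<in>I. \<mu> i * d i) < 0"
proof -
  define v where "v = (\<lambda>i. (a i, d i))"
  define H where "H = convex_cone hull (insert (0, 1) (v ` I))"
  define Q where "Q = {y. \<exists>\<mu> \<tau>. (\<forall>i\<in>I. 0 \<le> \<mu> i) \<and> 0 \<le> \<tau> \<and> y = (\<Sum>i\<in>I. \<mu> i *\<^sub>R v i) + \<tau> *\<^sub>R (0, 1)}"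
  have "H \<subseteq> Q"
    unfolding H_def
  proof (rule hull_minimal)
    have "(0, 1) \<in> Q"
      unfolding Q_def by (intro CollectI exI[of _ "\<lambda>_. 0"] exI[of _ 1]) auto
    moreover have "v j \<in> Q" if "j \<in> I" for j
      unfolding Q_def using that I
      by (intro CollectI exI[of _ "\<lambda>i. if i = j then 1 else 0"] exI[of _ 0]) (auto simp: if_distrib[of "\<lambda>c. c *\<^sub>R _"] zero_prod_def[symmetric] cong: if_cong)
    ultimately show "insert (0, 1) (v ` I) \<subseteq> Q" by blast
    show "convex_cone Q"
      unfolding convex_cone_iff
    proof (intro conjI ballI allI impI)
      show "0 \<in> Q"
        unfolding Q_def by (intro CollectI exI[of _ "\<lambda>_. 0"] exI[of _ 0]) (auto simp: zero_prod_def[symmetric])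
    next
      fix x y assume "x \<in> Q" "y \<in> Q"
      then obtain \<mu> \<tau> \<mu>' \<tau>' where
        "\<forall>i\<in>I. 0 \<le> \<mu> i" "0 \<le> \<tau>" "x = (\<Sum>i\<in>I. \<mu> i *\<^sub>R v i) + \<tau> *\<^sub>R (0, 1)"
        "\<forall>i\<in>I. 0 \<le> \<mu>' i" "0 \<le> \<tau>'" "y = (\<Sum>i\<in>I. \<mu>' i *\<^sub>R v i) + \<tau>' *\<^sub>R (0, 1)"
        unfolding Q_def by blast
      thus "x + y \<in> Q" unfolding Q_def
        by (intro CollectI exI[of _ "\<lambda>i. \<mu> i + \<mu>' i"] exI[of _ "\<tau> + \<tau>'"])
           (auto simp: sum.distrib scaleR_add_left)
    next
      fix x and c :: real assume "x \<in> Q" and c: "0 \<le> c"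
      then obtain \<mu> \<tau> where
        "\<forall>i\<in>I. 0 \<le> \<mu> i" "0 \<le> \<tau>" "x = (\<Sum>i\<in>I. \<mu> i *\<^sub>R v i) + \<tau> *\<^sub>R (0, 1)"
        unfolding Q_def by blast
      thus "c *\<^sub>R x \<in> Q" unfolding Q_def using c
        by (intro CollectI exI[of _ "\<lambda>i. c * \<mu> i"] exI[of _ "c * \<tau>"])
           (auto simp: scaleR_add_right scaleR_sum_right)
    qed
  qed
  have "(0, -1) \<in> H"
  proof (rule ccontr)
    assume "(0, -1) \<notin> H"
    moreover have "closed H" "convex H"
      unfolding H_def using I by (auto intro: closed_convex_cone_hull convex_convex_cone_hull)
    ultimately obtain n c where sep: "n \<bullet> (0, -1) < c" "\<And>x. x \<in> H \<Longrightarrow> c < n \<bullet> x"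
      using separating_hyperplane_closed_point[of H "(0, -1)"] by blast
    have "0 \<in> H" unfolding H_def by (rule convex_cone_hull_contains_0)
    hence c: "c < 0" using sep(2)[of 0] by simp
    have nn: "0 \<le> n \<bullet> x" if "x \<in> H" for x
    proof (rule ccontr)
      assume neg: "\<not> 0 \<le> n \<bullet> x"
      \<comment> \<open>Rescaled so that its product with \<open>n\<close> is exactly
        \<open>c\<close>, which the strict separation forbids.\<close>
      have "(c / (n \<bullet> x)) *\<^sub>R x \<in> H"
        using that neg c unfolding H_def by (intro convex_cone_hull_mul) (auto simp: divide_nonpos_neg)
      from sep(2)[OF this] show False using neg by simp
    qed
    obtain y \<tau> where n: "n = (y, \<tau>)" by (cases n)
    have \<tau>: "\<tau> > 0" using sep(1) c by (simp add: n)
    have "a i \<bullet> (- (1 / \<tau>) *\<^sub>R y) \<le> d i" if "i \<in> I" for i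
    proof -
      have "v i \<in> H" unfolding H_def using that by (auto intro: hull_inc)
      hence "0 \<le> y \<bullet> a i + \<tau> * d i" using nn[of "v i"] by (simp add: n v_def)
      thus ?thesis using \<tau> by (simp add: inner_commute field_simps)
    qed
    thus False using inc by blast
  qed
  hence "(0, -1) \<in> Q" using \<open>H \<subseteq> Q\<close> by blast
  then obtain \<mu> \<tau> where \<mu>: "\<forall>i\<in>I. 0 \<le> \<mu> i" "0 \<le> \<tau>"
      "(0, -1) = (\<Sum>i\<in>I. \<mu> i *\<^sub>R v i) + \<tau> *\<^sub>R (0, 1)"
    unfolding Q_def by blast
  have "(\<Sum>i\<in>I. \<mu> i *\<^sub>R v i) = (\<Sum>i\<in>I. \<mu> i *\<^sub>R a i, \<Sum>i\<in>I. \<mu> i * d i)"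
    by (simp add: prod_eq_iff fst_sum snd_sum v_def)
  hence "(\<Sum>i\<in>I. \<mu> i *\<^sub>R a i) = 0" "(\<Sum>i\<in>I. \<mu> i * d i) + \<tau> = -1" using \<mu>(3) by (simp_all add: prod_eq_iff)
  thus ?thesis using \<mu> by (intro exI[of _ \<mu>]) auto
qed

text \<open>In a certificate of inconsistency of minimal support the coefficients are unique up to scaling:
  moving along any other relation, normalised to keep the strict inequality, would kill a coefficient.\<close>

lemma farkas_circuit:
  fixes a :: "'i \<Rightarrow> 'a::euclidean_space" and d :: "'i \<Rightarrow> real"
  assumes I: "finite I" and inc: "\<nexists>x. \<forall>i\<in>I. a i \<bullet> x \<le> d i"
  shows "\<exists>J \<mu>. J \<subseteq> I \<and> (\<forall>i\<in>J. 0 < \<mu> i) \<and> (\<Sum>i\<in>J. \<mu> i *\<^sub>R a i) = 0 \<and> (\<Sum>i\<in>J. \<mu> i * d i) < 0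
     \<and> (\<forall>\<nu>. (\<Sum>i\<in>J. \<nu> i *\<^sub>R a i) = 0 \<longrightarrow> (\<exists>c. \<forall>i\<in>J. \<nu> i = c * \<mu> i))"
proof -
  define P where "P = (\<lambda>J. J \<subseteq> I \<and> (\<exists>\<mu>. (\<forall>i\<in>J. (0::real) < \<mu> i) \<and> (\<Sum>i\<in>J. \<mu> i *\<^sub>R a i) = 0 \<and> (\<Sum>i\<in>J. \<mu> i * d i) < 0))"
  have restrict: "P {i\<in>J. 0 < \<mu> i}"
    if "J \<subseteq> I" "\<forall>i\<in>J. 0 \<le> \<mu> i" "(\<Sum>i\<in>J. \<mu> i *\<^sub>R a i) = 0" "(\<Sum>i\<in>J. \<mu> i * d i) < 0" for J and \<mu> :: "'i \<Rightarrow> real"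
  proof -
    have fin: "finite J" using that I finite_subset by blast
    have z: "\<mu> i = 0" if "i \<in> J - {i\<in>J. 0 < \<mu> i}" for i
      using that \<open>\<forall>i\<in>J. 0 \<le> \<mu> i\<close> by force
    have "(\<Sum>i\<in>{i\<in>J. 0 < \<mu> i}. \<mu> i *\<^sub>R a i) = (\<Sum>i\<in>J. \<mu> i *\<^sub>R a i)"
      by (rule sum.mono_neutral_left[OF fin]) (use z in auto)
    moreover have "(\<Sum>i\<in>{i\<in>J. 0 < \<mu> i}. \<mu> i * d i) = (\<Sum>i\<in>J. \<mu> i * d i)"
      by (rule sum.mono_neutral_left[OF fin]) (use z in auto)
    ultimately show ?thesis unfolding P_def using that by (intro conjI exI[of _ \<mu>]) auto
  qed
  have "\<exists>J. P J" using farkas_inconsistent_system[OF I inc] restrict[OF order.refl] by blast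
  then obtain J where J: "P J" and min: "\<And>J'. P J' \<Longrightarrow> card J \<le> card J'"
    using ex_has_least_nat[of P _ card] by blast
  then obtain \<mu> where \<mu>: "J \<subseteq> I" "\<forall>i\<in>J. 0 < \<mu> i" "(\<Sum>i\<in>J. \<mu> i *\<^sub>R a i) = 0" "(\<Sum>i\<in>J. \<mu> i * d i) < 0"
    unfolding P_def by blast
  have fin: "finite J" using \<mu> I finite_subset by blast
  have no_neg: "\<not> (\<exists>i\<in>J. \<nu> i < 0)"
    if \<nu>: "(\<Sum>i\<in>J. \<nu> i *\<^sub>R a i) = 0" "(\<Sum>i\<in>J. \<nu> i * d i) = 0" for \<nu> :: "'i \<Rightarrow> real"
  proof
    assume ex: "\<exists>i\<in>J. \<nu> i < 0"
    define N where "N = {i\<in>J. \<nu> i < 0}"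
    \<comment> \<open>The first \<open>t\<close> at which a coefficient of
      \<open>\<mu> + t * \<nu>\<close> vanishes, which happens at \<open>k\<close>.\<close>
    define t where "t = Min ((\<lambda>i. \<mu> i / - \<nu> i) ` N)"
    have N: "finite N" "N \<noteq> {}" using fin ex by (auto simp: N_def)
    hence "t \<in> (\<lambda>i. \<mu> i / - \<nu> i) ` N" unfolding t_def by (intro Min_in) auto
    then obtain k where k: "k \<in> N" "t = \<mu> k / - \<nu> k" by blast
    have t: "t > 0" using k \<mu> by (auto simp: N_def intro!: divide_pos_neg)
    define \<mu>' where "\<mu>' = (\<lambda>i. \<mu> i + t * \<nu> i)"
    have nonneg: "0 \<le> \<mu>' i" if "i \<in> J" for i
    proof (cases "i \<in> N")
      case True
      hence "t \<le> \<mu> i / - \<nu> i" unfolding t_def using N by (intro Min_le) auto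
      thus ?thesis using True by (simp add: N_def \<mu>'_def field_simps)
    next
      case False
      thus ?thesis using that t \<mu> by (auto simp: N_def \<mu>'_def less_imp_le add_nonneg_nonneg)
    qed
    have "(\<Sum>i\<in>J. \<mu>' i *\<^sub>R a i) = (\<Sum>i\<in>J. \<mu> i *\<^sub>R a i) + t *\<^sub>R (\<Sum>i\<in>J. \<nu> i *\<^sub>R a i)"
      by (simp add: \<mu>'_def scaleR_add_left sum.distrib scaleR_sum_right)
    moreover have "(\<Sum>i\<in>J. \<mu>' i * d i) = (\<Sum>i\<in>J. \<mu> i * d i) + t * (\<Sum>i\<in>J. \<nu> i * d i)"
      by (simp add: \<mu>'_def distrib_right sum.distrib sum_distrib_left mult.assoc)
    ultimately have "P {i\<in>J. 0 < \<mu>' i}" using \<mu> \<nu> nonneg by (intro restrict) auto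
    hence "card J \<le> card {i\<in>J. 0 < \<mu>' i}" by (rule min)
    moreover have "{i\<in>J. 0 < \<mu>' i} \<subset> J"
    proof -
      have "\<mu>' k = 0" "k \<in> J" using k by (auto simp: \<mu>'_def N_def)
      hence "k \<notin> {i\<in>J. 0 < \<mu>' i}" by simp
      thus ?thesis using \<open>k \<in> J\<close> by blast
    qed
    ultimately show False using fin by (meson psubset_card_mono leD)
  qed
  have "\<exists>c. \<forall>i\<in>J. \<nu> i = c * \<mu> i" if \<nu>: "(\<Sum>i\<in>J. \<nu> i *\<^sub>R a i) = 0" for \<nu>
  proof -
    define c where "c = (\<Sum>i\<in>J. \<nu> i * d i) / (\<Sum>i\<in>J. \<mu> i * d i)"
    define \<nu>' where "\<nu>' = (\<lambda>i. \<nu> i - c * \<mu> i)"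
    have a0: "(\<Sum>i\<in>J. \<nu>' i *\<^sub>R a i) = 0"
    proof -
      have "(\<Sum>i\<in>J. \<nu>' i *\<^sub>R a i) = (\<Sum>i\<in>J. \<nu> i *\<^sub>R a i) - c *\<^sub>R (\<Sum>i\<in>J. \<mu> i *\<^sub>R a i)"
        by (simp add: \<nu>'_def scaleR_diff_left sum_subtractf scaleR_sum_right)
      thus ?thesis using \<nu> \<mu> by simp
    qed
    have d0: "(\<Sum>i\<in>J. \<nu>' i * d i) = 0"
    proof -
      have "(\<Sum>i\<in>J. \<nu>' i * d i) = (\<Sum>i\<in>J. \<nu> i * d i) - c * (\<Sum>i\<in>J. \<mu> i * d i)"
        by (simp add: \<nu>'_def left_diff_distrib sum_subtractf sum_distrib_left mult.assoc)
      thus ?thesis using \<mu> by (simp add: c_def)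
    qed
    have "\<not> (\<exists>i\<in>J. \<nu>' i < 0)" using no_neg[OF a0 d0] .
    moreover have "\<not> (\<exists>i\<in>J. - \<nu>' i < 0)"
      using a0 d0 by (intro no_neg) (simp_all add: sum_negf)
    ultimately have "\<forall>i\<in>J. \<nu>' i = 0" by force
    thus ?thesis by (auto simp: \<nu>'_def)
  qed
  thus ?thesis using \<mu> by blast
qed

text \<open>A relation with coefficient 0 at \<open>k\<close> is trivial, so the remaining
  \<open>a i\<close> are independent and a linear functional may take any values on them. The vector
  representing it is the vertex opposite to facet \<open>k\<close>.\<close>

lemma circuit_vertex_exists:
  fixes a :: "'i \<Rightarrow> 'a::euclidean_space" and b \<mu> :: "'i \<Rightarrow> real"
  assumes J: "finite J" and k: "k \<in> J" and \<mu>k: "\<mu> k \<noteq> 0"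
    and circ: "\<And>\<nu>. (\<Sum>i\<in>J. \<nu> i *\<^sub>R a i) = 0 \<Longrightarrow> \<exists>c. \<forall>i\<in>J. \<nu> i = c * \<mu> i"
  shows "\<exists>v. \<forall>i\<in>J - {k}. a i \<bullet> v = b i"
proof -
  have rel0: "\<nu> i = 0" if rel: "(\<Sum>i\<in>J. \<nu> i *\<^sub>R a i) = 0" "\<nu> k = 0" "i \<in> J" for \<nu> i
  proof -
    obtain c where c: "\<forall>i\<in>J. \<nu> i = c * \<mu> i" using circ[OF rel(1)] by blast
    hence "c * \<mu> k = 0" using k rel(2) by force
    thus ?thesis using c \<mu>k rel(3) by simp
  qed
  define J' where "J' = J - {k}"
  have fin: "finite J'" using J by (simp add: J'_def)
  have rel0': "\<nu> i = 0" if rel: "(\<Sum>i\<in>J'. \<nu> i *\<^sub>R a i) = 0" and i: "i \<in> J'" for \<nu> i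
  proof -
    define \<nu>' where "\<nu>' = (\<lambda>i. if i = k then 0 else \<nu> i)"
    have "(\<Sum>i\<in>J. \<nu>' i *\<^sub>R a i) = \<nu>' k *\<^sub>R a k + (\<Sum>i\<in>J'. \<nu>' i *\<^sub>R a i)"
      unfolding J'_def by (rule sum.remove[OF J k])
    also have "(\<Sum>i\<in>J'. \<nu>' i *\<^sub>R a i) = (\<Sum>i\<in>J'. \<nu> i *\<^sub>R a i)"
      by (intro sum.cong) (auto simp: \<nu>'_def J'_def)
    finally have "(\<Sum>i\<in>J. \<nu>' i *\<^sub>R a i) = 0" using rel by (simp add: \<nu>'_def)
    from rel0[OF this, of i] show ?thesis using i by (simp add: \<nu>'_def J'_def)
  qed
  have inj: "inj_on a J'"
  proof (rule inj_onI, rule ccontr)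
    fix i j assume ij: "i \<in> J'" "j \<in> J'" "a i = a j" "i \<noteq> j"
    have "(\<Sum>l\<in>J'. ((if l = i then 1 else 0) - (if l = j then 1 else 0)) *\<^sub>R a l) = a i - a j"
      using ij fin by (simp add: scaleR_diff_left sum_subtractf if_distrib[of "\<lambda>c. c *\<^sub>R _"] cong: if_cong)
    from rel0'[OF this[unfolded ij(3) diff_self] ij(1)] show False using ij(4) by simp
  qed
  have "independent (a ` J')"
  proof (rule independent_if_scalars_zero)
    fix f x assume f: "(\<Sum>x\<in>a ` J'. f x *\<^sub>R x) = 0" "x \<in> a ` J'"
    then obtain i where i: "i \<in> J'" "x = a i" by blast
    have "(\<Sum>i\<in>J'. f (a i) *\<^sub>R a i) = 0" using f(1) inj by (simp add: sum.reindex)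
    from rel0'[OF this i(1)] show "f x = 0" using i by simp
  qed (use fin in auto)
  from linear_independent_extend[OF this, of "\<lambda>y. b (inv_into J' a y)"]
  obtain g where g: "linear g" "\<And>i. i \<in> J' \<Longrightarrow> g (a i) = b i" using inj by auto
  have "a i \<bullet> adjoint g 1 = b i" if "i \<in> J'" for i
    using adjoint_works[OF g(1), of "a i" 1] g(2)[OF that] by simp
  thus ?thesis by (auto simp: J'_def)
qed

text \<open>\<open>lam i\<close> are barycentric coordinates for the vertices
  \<open>L (v k)\<close>, and the facet opposite to \<open>L (v k)\<close> is where
  \<open>lam k\<close> vanishes. A general \<open>L\<close> serves simplices (\<open>id\<close>) and
  strips (a map collapsing the common kernel of the \<open>a i\<close>) alike.\<close>

lemma circuit_simplex:
  fixes a :: "'i \<Rightarrow> 'a::euclidean_space" and b \<mu> :: "'i \<Rightarrow> real" and L :: "'a \<Rightarrow> 'b::euclidean_space"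
  assumes J: "finite J" and \<mu>: "\<And>i. i \<in> J \<Longrightarrow> 0 < \<mu> i"
    and a0: "(\<Sum>i\<in>J. \<mu> i *\<^sub>R a i) = 0" and b1: "(\<Sum>i\<in>J. \<mu> i * b i) = 1"
    and circ: "\<And>\<nu>. (\<Sum>i\<in>J. \<nu> i *\<^sub>R a i) = 0 \<Longrightarrow> \<exists>c. \<forall>i\<in>J. \<nu> i = c * \<mu> i"
    and L: "linear L" and ker: "\<And>x. L x = 0 \<longleftrightarrow> (\<forall>i\<in>J. a i \<bullet> x = 0)"
  shows "\<exists>C. \<not> affine_dependent C \<and> affine hull C = range L
     \<and> L -` (convex hull C) = {x. \<forall>i\<in>J. a i \<bullet> x \<le> b i}
     \<and> (\<forall>G. G facet_of convex hull C \<longrightarrow>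
          (\<exists>k\<in>J. \<forall>x. (\<forall>i\<in>J. a i \<bullet> x \<le> b i) \<and> a k \<bullet> x = b k \<longrightarrow> L x \<in> G))"
proof -
  have "\<forall>k. \<exists>v. k \<in> J \<longrightarrow> (\<forall>i\<in>J - {k}. a i \<bullet> v = b i)"
  proof
    fix k
    show "\<exists>v. k \<in> J \<longrightarrow> (\<forall>i\<in>J - {k}. a i \<bullet> v = b i)"
    proof (cases "k \<in> J")
      case True
      hence "\<mu> k \<noteq> 0" using \<mu>[of k] by simp
      have "\<exists>v. \<forall>i\<in>J - {k}. a i \<bullet> v = b i"
        by (rule circuit_vertex_exists[where \<mu> = \<mu>, OF J True \<open>\<mu> k \<noteq> 0\<close>]) (rule circ)
      thus ?thesis by simp
    qed auto
  qed
  then obtain v where v: "\<And>k i. k \<in> J \<Longrightarrow> i \<in> J - {k} \<Longrightarrow> a i \<bullet> v k = b i" by metis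
  define lam where "lam = (\<lambda>i x. \<mu> i * (b i - a i \<bullet> x))"
  have lam_sum: "(\<Sum>i\<in>J. lam i x) = 1" for x
  proof -
    have "(\<Sum>i\<in>J. lam i x) = (\<Sum>i\<in>J. \<mu> i * b i) - (\<Sum>i\<in>J. \<mu> i *\<^sub>R a i) \<bullet> x"
      by (simp add: lam_def right_diff_distrib sum_subtractf inner_sum_left)
    thus ?thesis using a0 b1 by simp
  qed
  have lam_v: "lam i (v k) = (if i = k then 1 else 0)" if "i \<in> J" "k \<in> J" for i k
  proof (cases "i = k")
    case True
    have "(\<Sum>j\<in>J. lam j (v k)) = lam k (v k) + (\<Sum>j\<in>J - {k}. lam j (v k))"
      using J that by (intro sum.remove) auto
    also have "(\<Sum>j\<in>J - {k}. lam j (v k)) = 0"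
      using v that by (intro sum.neutral) (auto simp: lam_def)
    finally show ?thesis using True lam_sum by simp
  qed (use v that in \<open>auto simp: lam_def\<close>)
  \<comment> \<open>Homogeneous form, valid for any coefficient sum: sum 0 yields affine
    independence, sum 1 the coordinates.\<close>
  have lam_comb: "\<mu> i * (b i * (\<Sum>k\<in>J. c k) - a i \<bullet> (\<Sum>k\<in>J. c k *\<^sub>R v k)) = c i" if "i \<in> J" for i c
  proof -
    have "\<mu> i * (b i * (\<Sum>k\<in>J. c k) - a i \<bullet> (\<Sum>k\<in>J. c k *\<^sub>R v k)) = (\<Sum>k\<in>J. c k * lam i (v k))"
      by (simp add: lam_def inner_sum_right sum_distrib_left sum_subtractf right_diff_distrib algebra_simps)
    also have "\<dots> = (\<Sum>k\<in>J. if k = i then c k else 0)"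
      using lam_v that by (intro sum.cong) auto
    finally show ?thesis using J that by simp
  qed
  have lam_comb1: "lam i (\<Sum>k\<in>J. c k *\<^sub>R v k) = c i" if "i \<in> J" "(\<Sum>k\<in>J. c k) = 1" for i c
    using lam_comb[OF that(1), of c] that(2) by (simp add: lam_def)
  have L_eq: "L x = L y \<longleftrightarrow> (\<forall>i\<in>J. lam i x = lam i y)" for x y
  proof -
    have "L x = L y \<longleftrightarrow> L (x - y) = 0" using L by (simp add: linear_diff)
    also have "\<dots> \<longleftrightarrow> (\<forall>i\<in>J. a i \<bullet> x = a i \<bullet> y)" unfolding ker by (simp add: inner_diff_right)
    also have "\<dots> \<longleftrightarrow> (\<forall>i\<in>J. lam i x = lam i y)" using \<mu> by (force simp: lam_def)
    finally show ?thesis .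
  qed
  have L_sum: "L (\<Sum>k\<in>J. c k *\<^sub>R v k) = (\<Sum>k\<in>J. c k *\<^sub>R L (v k))" for c
    using L by (simp add: linear_sum linear_scale)
  have L_exp: "L x = (\<Sum>k\<in>J. lam k x *\<^sub>R L (v k))" for x
    unfolding L_sum[symmetric] L_eq
    using lam_comb1[of _ "\<lambda>k. lam k x"] lam_sum[of x] by simp
  define C where "C = (\<lambda>k. L (v k)) ` J"
  have inj: "inj_on (\<lambda>k. L (v k)) J"
  proof (rule inj_onI)
    fix i j assume ij: "i \<in> J" "j \<in> J" "L (v i) = L (v j)"
    hence "lam i (v i) = lam i (v j)" unfolding L_eq by blast
    thus "i = j" using lam_v ij by (simp split: if_splits)
  qed
  have finC: "finite C" using J by (simp add: C_def)
  have sumC: "(\<Sum>y\<in>C. f y) = (\<Sum>k\<in>J. f (L (v k)))" for f :: "'b \<Rightarrow> 'c::comm_monoid_add"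
    unfolding C_def using inj by (simp add: sum.reindex)
  have indep: "\<not> affine_dependent C"
  proof
    assume "affine_dependent C"
    then obtain U where U: "sum U C = 0" "\<exists>y\<in>C. U y \<noteq> 0" "(\<Sum>y\<in>C. U y *\<^sub>R y) = 0"
      using affine_dependent_explicit_finite[OF finC] by blast
    define c where "c = (\<lambda>k. U (L (v k)))"
    have c0: "(\<Sum>k\<in>J. c k) = 0" using U(1) by (simp add: sumC c_def)
    have "L (\<Sum>k\<in>J. c k *\<^sub>R v k) = 0" using U(3) by (simp add: L_sum sumC c_def)
    hence "\<forall>i\<in>J. a i \<bullet> (\<Sum>k\<in>J. c k *\<^sub>R v k) = 0" unfolding ker .
    hence "\<forall>i\<in>J. c i = 0" using lam_comb[of _ c] c0 by simp
    thus False using U(2) by (auto simp: C_def c_def)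
  qed
  have aff: "affine hull C = range L"
  proof
    have "affine (range L)" by (intro subspace_imp_affine linear_subspace_image L subspace_UNIV)
    thus "affine hull C \<subseteq> range L" by (intro hull_minimal) (auto simp: C_def)
    show "range L \<subseteq> affine hull C"
    proof
      fix y assume "y \<in> range L"
      then obtain x where x: "y = L x" by blast
      define u where "u = (\<lambda>y. lam (inv_into J (\<lambda>k. L (v k)) y) x)"
      have "u (L (v k)) = lam k x" if "k \<in> J" for k using inv_into_f_f[OF inj that] by (simp add: u_def)
      hence "sum u C = 1" "(\<Sum>y\<in>C. u y *\<^sub>R y) = y"
        using lam_sum[of x] L_exp[of x] by (simp_all add: sumC x)
      thus "y \<in> affine hull C" unfolding affine_hull_finite[OF finC] by blast
    qed
  qed
  have pre: "L -` (convex hull C) = {x. \<forall>i\<in>J. a i \<bullet> x \<le> b i}"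
  proof (intro equalityI subsetI CollectI ballI)
    fix x i assume "x \<in> L -` (convex hull C)" and i: "i \<in> J"
    then obtain u where u: "\<And>y. y \<in> C \<Longrightarrow> 0 \<le> u y" "sum u C = 1" "(\<Sum>y\<in>C. u y *\<^sub>R y) = L x"
      unfolding convex_hull_finite[OF finC] by auto
    define c where "c = (\<lambda>k. u (L (v k)))"
    have c: "(\<Sum>k\<in>J. c k) = 1" using u(2) by (simp add: sumC c_def)
    have ci: "0 \<le> c i" using u(1) i by (simp add: c_def C_def)
    have "L x = L (\<Sum>k\<in>J. c k *\<^sub>R v k)" using u(3) by (simp add: L_sum sumC c_def)
    hence "lam i x = c i" unfolding L_eq using i lam_comb1[OF i c] by simp
    hence "0 \<le> \<mu> i * (b i - a i \<bullet> x)" using ci by (simp add: lam_def)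
    thus "a i \<bullet> x \<le> b i" using \<mu>[OF i] by (simp add: zero_le_mult_iff)
  next
    fix x assume "x \<in> {x. \<forall>i\<in>J. a i \<bullet> x \<le> b i}"
    hence "(\<Sum>k\<in>J. lam k x *\<^sub>R L (v k)) \<in> convex hull C"
      using J lam_sum[of x] \<mu>
      by (intro convex_sum) (auto simp: lam_def C_def less_imp_le intro!: mult_nonneg_nonneg hull_inc)
    thus "x \<in> L -` (convex hull C)" using L_exp[of x] by simp
  qed
  have "\<exists>k\<in>J. \<forall>x. (\<forall>i\<in>J. a i \<bullet> x \<le> b i) \<and> a k \<bullet> x = b k \<longrightarrow> L x \<in> G"
    if G: "G facet_of convex hull C" for G
  proof -
    obtain y where y: "y \<in> C" "G = convex hull (C - {y})"
      using G unfolding facet_of_convex_hull_affine_independent[OF indep] by blast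
    obtain k where k: "k \<in> J" "y = L (v k)" using y(1) unfolding C_def by blast
    have "L x \<in> G" if x: "\<forall>i\<in>J. a i \<bullet> x \<le> b i" "a k \<bullet> x = b k" for x
    proof -
      have lk: "lam k x = 0" using x by (simp add: lam_def)
      have "(\<Sum>i\<in>J - {k}. lam i x) = 1" using lam_sum[of x] sum.remove[OF J k(1), of "\<lambda>i. lam i x"] lk by simp
      hence "(\<Sum>i\<in>J - {k}. lam i x *\<^sub>R L (v i)) \<in> convex hull (C - {y})"
      proof (intro convex_sum)
        fix i assume i: "i \<in> J - {k}"
        show "0 \<le> lam i x" using i x \<mu> by (simp add: lam_def less_imp_le)
        have "L (v i) \<noteq> L (v k)" using inj_onD[OF inj, of i k] i k(1) by auto
        thus "L (v i) \<in> convex hull (C - {y})" using i k(2) by (intro hull_inc) (auto simp: C_def)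
      qed (use J in auto)
      also have "(\<Sum>i\<in>J - {k}. lam i x *\<^sub>R L (v i)) = L x"
        using L_exp[of x] sum.remove[OF J k(1), of "\<lambda>i. lam i x *\<^sub>R L (v i)"] lk by simp
      finally show ?thesis using y(2) by simp
    qed
    thus ?thesis using k(1) by blast
  qed
  thus ?thesis using indep aff pre by blast
qed

section \<open>Supporting simplices and strips\<close>

lemma polyhedron_facet_representation:
  fixes S :: "'a::euclidean_space set"
  assumes "polyhedron S"
  obtains H a b where "finite H" "S = affine hull S \<inter> \<Inter>H"
    "\<And>h. h \<in> H \<Longrightarrow> a h \<noteq> 0 \<and> h = {x. a h \<bullet> x \<le> b h}"
    "\<And>C. C facet_of S \<longleftrightarrow> (\<exists>h\<in>H. C = S \<inter> {x. a h \<bullet> x = b h})"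
proof -
  obtain H where H: "finite H" "S = affine hull S \<inter> \<Inter>H"
      "\<forall>h\<in>H. \<exists>a b. a \<noteq> 0 \<and> h = {x. a \<bullet> x \<le> b}"
      "\<forall>H'. H' \<subset> H \<longrightarrow> S \<subset> affine hull S \<inter> \<Inter>H'"
    using assms unfolding polyhedron_Int_affine_minimal by blast
  then obtain a b where ab: "\<And>h. h \<in> H \<Longrightarrow> a h \<noteq> 0 \<and> h = {x. a h \<bullet> x \<le> b h}" by metis
  have "C facet_of S \<longleftrightarrow> (\<exists>h\<in>H. C = S \<inter> {x. a h \<bullet> x = b h})" for C
    using facet_of_polyhedron_explicit[OF H(1,2) ab] H(4) by blast
  thus thesis using that H(1,2) ab by blast
qed

text \<open>\<open>G\<close> spans the hyperplane of \<open>a\<close>, which forces \<open>c\<close>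
  to be a multiple of \<open>a\<close>; the point \<open>x0\<close> fixes the sign of the
  factor.\<close>

lemma halfspace_eq_of_facet:
  fixes a c :: "'a::euclidean_space"
  assumes a: "a \<noteq> 0" and c: "c \<noteq> 0" and x0: "a \<bullet> x0 < b" "c \<bullet> x0 \<le> e"
    and G: "G \<noteq> {}" "aff_dim G = int DIM('a) - 1" "G \<subseteq> {x. a \<bullet> x = b}" "G \<subseteq> {x. c \<bullet> x = e}"
  shows "{x. c \<bullet> x \<le> e} = {x. a \<bullet> x \<le> b}"
proof -
  have "affine hull G = {x. a \<bullet> x = b}"
  proof (rule affine_dim_equal)
    show "affine hull G \<subseteq> {x. a \<bullet> x = b}"
      using G by (intro hull_minimal) (auto simp: affine_hyperplane)
    show "aff_dim (affine hull G) = aff_dim {x. a \<bullet> x = b}"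
      using G a by simp
  qed (use G in \<open>auto simp: affine_hyperplane\<close>)
  moreover have "affine hull G \<subseteq> {x. c \<bullet> x = e}"
    using G by (intro hull_minimal) (auto simp: affine_hyperplane)
  ultimately have sub: "\<And>x. a \<bullet> x = b \<Longrightarrow> c \<bullet> x = e" by blast
  obtain p where p: "p \<in> G" using G by blast
  hence pa: "a \<bullet> p = b" "c \<bullet> p = e" using G by auto
  define \<kappa> where "\<kappa> = (c \<bullet> a) / (a \<bullet> a)"
  \<comment> \<open>The part of \<open>c\<close> orthogonal to \<open>a\<close>; moving from
    \<open>p\<close> along \<open>v\<close> stays in the hyperplane, so \<open>c\<close> is
    orthogonal to \<open>v\<close> as well.\<close>
  define v where "v = c - \<kappa> *\<^sub>R a"
  have "a \<bullet> v = 0" using a by (simp add: v_def \<kappa>_def inner_diff_right inner_commute)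
  moreover from this have "c \<bullet> v = 0"
    using sub[of "p + v"] pa by (simp add: inner_add_right)
  ultimately have "v \<bullet> v = 0" by (simp add: v_def inner_diff_left)
  hence ca: "c = \<kappa> *\<^sub>R a" by (simp add: v_def)
  hence e: "e = \<kappa> * b" using pa by simp
  have "\<kappa> \<noteq> 0" using c ca by auto
  moreover have "\<kappa> \<ge> 0"
  proof (rule ccontr)
    assume "\<not> \<kappa> \<ge> 0"
    hence "\<kappa> * b < \<kappa> * (a \<bullet> x0)" using x0(1) by simp
    thus False using x0(2) ca e by simp
  qed
  ultimately show ?thesis unfolding ca e by simp
qed

locale full_polytope =
  fixes K :: "(real ^ 'd) set" and H :: "(real ^ 'd) set set"
    and a :: "(real ^ 'd) set \<Rightarrow> real ^ 'd" and b :: "(real ^ 'd) set \<Rightarrow> real"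
  assumes polytope: "polytope K" and full_dim: "aff_dim K = int CARD('d)"
    and finH: "finite H" and K_eq: "K = \<Inter>H"
    and halfspace: "\<And>h. h \<in> H \<Longrightarrow> a h \<noteq> 0 \<and> h = {x. a h \<bullet> x \<le> b h}"
    and facets: "\<And>C. C facet_of K \<longleftrightarrow> (\<exists>h\<in>H. C = K \<inter> {x. a h \<bullet> x = b h})"
begin

lemma mem_K: "x \<in> K \<longleftrightarrow> (\<forall>h\<in>H. a h \<bullet> x \<le> b h)"
proof -
  have "x \<in> h \<longleftrightarrow> a h \<bullet> x \<le> b h" if "h \<in> H" for h using halfspace[OF that] by blast
  thus ?thesis by (simp add: K_eq)
qed

lemma strict_point: "\<exists>x\<in>K. \<forall>h\<in>H. a h \<bullet> x < b h"
proof -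
  have "affine hull K = UNIV"
    using full_dim aff_dim_eq_full[of K] by simp
  moreover have "K \<noteq> {}" using full_dim by auto
  moreover have "convex K" using polytope by (rule polytope_imp_convex)
  ultimately have "interior K \<noteq> {}"
    using rel_interior_interior[of K] rel_interior_eq_empty[of K] by simp
  then obtain x where x: "x \<in> interior K" by blast
  have "a h \<bullet> x < b h" if h: "h \<in> H" for h
  proof -
    have "interior K \<subseteq> interior {x. a h \<bullet> x \<le> b h}"
      using h mem_K by (intro interior_mono) auto
    moreover have "interior {x. a h \<bullet> x \<le> b h} = {x. a h \<bullet> x < b h}"
      using halfspace[OF h] by (intro interior_halfspace_le) simp
    ultimately show ?thesis using x by blast
  qed
  thus ?thesis using x interior_subset by blast
qed

text \<open>Full rank of \<open>L\<close> gives a simplex, smaller rank a strip. The facet condition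
  holds because every index in \<open>J\<close> belongs to a facet of \<open>K\<close>.\<close>

lemma circuit_in_SK:
  assumes J: "J \<subseteq> H" and \<mu>: "\<And>h. h \<in> J \<Longrightarrow> 0 < \<mu> h"
    and a0: "(\<Sum>h\<in>J. \<mu> h *\<^sub>R a h) = 0" and b1: "(\<Sum>h\<in>J. \<mu> h * b h) = 1"
    and circ: "\<And>\<nu>. (\<Sum>h\<in>J. \<nu> h *\<^sub>R a h) = 0 \<Longrightarrow> \<exists>c. \<forall>h\<in>J. \<nu> h = c * \<mu> h"
  shows "{x. \<forall>h\<in>J. a h \<bullet> x \<le> b h} \<in> SK K"
proof -
  define S where "S = {x. \<forall>h\<in>J. a h \<bullet> x \<le> b h}"
  have fin: "finite J" using J finH by (rule finite_subset)
  have KS: "K \<subseteq> S" using J mem_K by (auto simp: S_def)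
  \<comment> \<open>\<open>L x \<bullet> x\<close> is the sum of the
    \<open>(a h \<bullet> x)^2\<close>, so the kernel is the common null space of the
    \<open>a h\<close>.\<close>
  define L where "L = (\<lambda>x. \<Sum>h\<in>J. (a h \<bullet> x) *\<^sub>R a h)"
  have L: "linear L"
    by (rule linearI) (simp_all add: L_def inner_add_right scaleR_add_left sum.distrib scaleR_sum_right)
  have ker: "L x = 0 \<longleftrightarrow> (\<forall>h\<in>J. a h \<bullet> x = 0)" for x
  proof
    assume "L x = 0"
    hence "0 = L x \<bullet> x" by simp
    also have "\<dots> = (\<Sum>h\<in>J. (a h \<bullet> x)\<^sup>2)" by (simp add: L_def inner_sum_left power2_eq_square)
    finally show "\<forall>h\<in>J. a h \<bullet> x = 0" using fin by (simp add: sum_nonneg_eq_0_iff)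
  qed (simp add: L_def)
  show ?thesis
  proof (cases "dim (range L) = CARD('d)")
    case True
    hence "range L = UNIV"
      using dim_eq_full[of "range L"] L span_eq_iff[of "range L"] by (simp add: linear_subspace_image)
    hence "inj L" using linear_surjective_imp_injective[OF L] by simp
    hence "L x = 0 \<longleftrightarrow> x = 0" for x using linear_injective_0[OF L] linear_0[OF L] by blast
    hence "id x = 0 \<longleftrightarrow> (\<forall>h\<in>J. a h \<bullet> x = 0)" for x using ker by simp
    from circuit_simplex[of J \<mu> a b id, OF fin \<mu> a0 b1 circ linear_id this]
    obtain C where C: "\<not> affine_dependent C" "affine hull C = UNIV"
       "convex hull C = S"
       "\<And>G. G facet_of convex hull C \<Longrightarrow> \<exists>k\<in>J. \<forall>x. (\<forall>i\<in>J. a i \<bullet> x \<le> b i) \<and> a k \<bullet> x = b k \<longrightarrow> x \<in> G"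
      unfolding S_def by auto
    have "aff_dim C = int CARD('d)"
      using aff_dim_eq_full[of C] C(2) by simp
    hence "(int CARD('d)) simplex S"
      unfolding simplex_def using C(1,3) aff_dim_affine_independent[OF C(1)] by (intro exI[of _ C]) auto
    moreover have "\<exists>F. F facet_of K \<and> F \<subseteq> G" if G: "G facet_of S" for G
    proof -
      from C(4)[of G] G C(3) obtain k where k: "k \<in> J"
        "\<forall>x. (\<forall>i\<in>J. a i \<bullet> x \<le> b i) \<and> a k \<bullet> x = b k \<longrightarrow> x \<in> G" by auto
      hence "K \<inter> {x. a k \<bullet> x = b k} \<subseteq> G" using KS by (auto simp: S_def)
      moreover have "(K \<inter> {x. a k \<bullet> x = b k}) facet_of K" unfolding facets using k J by blast
      ultimately show ?thesis by blast
    qed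
    ultimately have "supporting_simplex K S" unfolding supporting_simplex_def using KS by blast
    thus ?thesis by (simp add: SK_def S_def)
  next
    case False
    from circuit_simplex[of J \<mu> a b L, OF fin \<mu> a0 b1 circ L ker]
    obtain C where C: "\<not> affine_dependent C" "affine hull C = range L"
       "L -` (convex hull C) = S"
       "\<And>G. G facet_of convex hull C \<Longrightarrow> \<exists>k\<in>J. \<forall>x. (\<forall>i\<in>J. a i \<bullet> x \<le> b i) \<and> a k \<bullet> x = b k \<longrightarrow> L x \<in> G"
      unfolding S_def by auto
    have "aff_dim C = int (dim (range L))"
      using aff_dim_affine_hull[of C] C(2) aff_dim_subspace[of "range L"] L by (simp add: linear_subspace_image)
    hence simp: "(int (dim (range L))) simplex (convex hull C)"
      unfolding simplex_def using C(1) aff_dim_affine_independent[OF C(1)] by (intro exI[of _ C]) auto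
    have "\<not> dim (range L) = 0"
    proof
      assume "dim (range L) = 0"
      hence "L x = 0" for x by (auto simp: dim_eq_0)
      hence "a h \<bullet> a h = 0" if "h \<in> J" for h using ker that by blast
      hence "J = {}" using J halfspace by fastforce
      thus False using b1 by simp
    qed
    hence "1 \<le> dim (range L)" by linarith
    moreover have "dim (range L) < CARD('d)"
      using dim_subset_UNIV[of "range L"] False by simp
    moreover have "convex hull C \<subseteq> range L" using C(2) convex_hull_subset_affine_hull by metis
    moreover have "\<exists>F. F facet_of K \<and> F \<subseteq> L -` G" if G: "G facet_of convex hull C" for G
    proof -
      from C(4)[OF G] obtain k where k: "k \<in> J"
        "\<forall>x. (\<forall>i\<in>J. a i \<bullet> x \<le> b i) \<and> a k \<bullet> x = b k \<longrightarrow> L x \<in> G" by auto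
      hence "K \<inter> {x. a k \<bullet> x = b k} \<subseteq> L -` G" using KS by (auto simp: S_def)
      moreover have "(K \<inter> {x. a k \<bullet> x = b k}) facet_of K" unfolding facets using k J by blast
      ultimately show ?thesis by blast
    qed
    ultimately have "supporting_strip K S"
      unfolding supporting_strip_def using L simp C(3)[symmetric] KS
      by blast
    thus ?thesis by (simp add: SK_def S_def)
  qed
qed

lemma inconsistent_system_circuit:
  assumes inc: "\<nexists>x. \<forall>h\<in>H. \<beta> h \<le> b h - a h \<bullet> x"
  shows "\<exists>J \<mu>. J \<subseteq> H \<and> (\<forall>h\<in>J. 0 < \<mu> h) \<and> (\<Sum>h\<in>J. \<mu> h *\<^sub>R a h) = 0 \<and> (\<Sum>h\<in>J. \<mu> h * b h) = 1
     \<and> 1 < (\<Sum>h\<in>J. \<mu> h * \<beta> h) \<and> {x. \<forall>h\<in>J. a h \<bullet> x \<le> b h} \<in> SK K"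
proof -
  have "\<nexists>x. \<forall>h\<in>H. a h \<bullet> x \<le> b h - \<beta> h" using inc by (simp add: algebra_simps)
  from farkas_circuit[OF finH this]
  obtain J \<mu> where J: "J \<subseteq> H" "\<forall>i\<in>J. 0 < \<mu> i" "(\<Sum>i\<in>J. \<mu> i *\<^sub>R a i) = 0" "(\<Sum>i\<in>J. \<mu> i * (b i - \<beta> i)) < 0"
    and circ: "\<forall>\<nu>. (\<Sum>i\<in>J. \<nu> i *\<^sub>R a i) = 0 \<longrightarrow> (\<exists>c. \<forall>i\<in>J. \<nu> i = c * \<mu> i)" by blast
  define \<kappa> where "\<kappa> = (\<Sum>h\<in>J. \<mu> h * b h)"
  have "J \<noteq> {}" using J(4) by auto
  have fin: "finite J" using J(1) finH by (rule finite_subset)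
  obtain x where x: "\<forall>h\<in>H. a h \<bullet> x < b h" using strict_point by blast
  \<comment> \<open>A strictly interior point shows that the normalising constant
    \<open>\<kappa>\<close> is positive.\<close>
  have "0 < (\<Sum>h\<in>J. \<mu> h * (b h - a h \<bullet> x))"
    using J x fin \<open>J \<noteq> {}\<close> by (intro sum_pos mult_pos_pos) auto
  also have "\<dots> = \<kappa> - (\<Sum>h\<in>J. \<mu> h *\<^sub>R a h) \<bullet> x"
    by (simp add: \<kappa>_def right_diff_distrib sum_subtractf inner_sum_left)
  finally have \<kappa>: "\<kappa> > 0" using J by simp
  define \<mu>' where "\<mu>' = (\<lambda>h. \<mu> h / \<kappa>)"
  have 1: "\<And>h. h \<in> J \<Longrightarrow> 0 < \<mu>' h" using J \<kappa> by (simp add: \<mu>'_def)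
  have "(\<Sum>h\<in>J. \<mu>' h *\<^sub>R a h) = (1 / \<kappa>) *\<^sub>R (\<Sum>h\<in>J. \<mu> h *\<^sub>R a h)"
    by (simp add: \<mu>'_def scaleR_sum_right)
  hence 2: "(\<Sum>h\<in>J. \<mu>' h *\<^sub>R a h) = 0" using J by simp
  have 3: "(\<Sum>h\<in>J. \<mu>' h * b h) = 1"
    using \<kappa> by (simp add: \<mu>'_def \<kappa>_def flip: sum_divide_distrib)
  have "\<kappa> - (\<Sum>h\<in>J. \<mu> h * \<beta> h) < 0"
    using J(4) by (simp add: \<kappa>_def right_diff_distrib sum_subtractf)
  hence 4: "1 < (\<Sum>h\<in>J. \<mu>' h * \<beta> h)"
    using \<kappa> by (simp add: \<mu>'_def flip: sum_divide_distrib)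
  have "\<exists>c. \<forall>h\<in>J. \<nu> h = c * \<mu>' h" if rel: "(\<Sum>h\<in>J. \<nu> h *\<^sub>R a h) = 0" for \<nu>
  proof -
    obtain c where "\<forall>h\<in>J. \<nu> h = c * \<mu> h" using circ rel by blast
    thus ?thesis using \<kappa> by (intro exI[of _ "c * \<kappa>"]) (simp add: \<mu>'_def)
  qed
  from circuit_in_SK[OF J(1) 1 2 3 this] show ?thesis using J(1) 1 2 3 4 by blast
qed

text \<open>The values \<open>\<beta>\<close> exceed what \<open>b h - a h \<bullet> x\<close> can
  attain on \<open>K\<close>, and solutions lie in \<open>K\<close> because
  \<open>\<beta> \<ge> 0\<close>; inconsistency then supplies a member.\<close>

lemma SK_nonempty: "SK K \<noteq> {}"
proof -
  have bdd: "bounded K" using polytope by (rule polytope_imp_bounded)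
  then obtain R where R: "\<And>x. x \<in> K \<Longrightarrow> norm x \<le> R" unfolding bounded_iff by blast
  have "H \<noteq> {}" using bdd K_eq by auto
  then obtain h where h: "h \<in> H" by blast
  define \<beta> where "\<beta> = (\<lambda>h. \<bar>b h\<bar> + norm (a h) * \<bar>R\<bar> + 1)"
  have "\<nexists>x. \<forall>h\<in>H. \<beta> h \<le> b h - a h \<bullet> x"
  proof
    assume "\<exists>x. \<forall>h\<in>H. \<beta> h \<le> b h - a h \<bullet> x"
    then obtain x where x: "\<forall>h\<in>H. \<beta> h \<le> b h - a h \<bullet> x" by blast
    have "0 \<le> \<beta> h" for h by (simp add: \<beta>_def)
    hence "\<forall>h\<in>H. 0 \<le> b h - a h \<bullet> x" using x order_trans by blast
    hence "x \<in> K" unfolding mem_K by simp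
    hence "\<bar>a h \<bullet> x\<bar> \<le> norm (a h) * \<bar>R\<bar>"
      using R[of x] by (intro order_trans[OF Cauchy_Schwarz_ineq2] mult_left_mono) auto
    moreover have "\<beta> h \<le> b h - a h \<bullet> x" using x h by blast
    ultimately show False unfolding \<beta>_def by linarith
  qed
  from inconsistent_system_circuit[OF this] show ?thesis by blast
qed

lemma SK_linear_preimage:
  assumes "S \<in> SK K"
  obtains L :: "real ^ 'd \<Rightarrow> real ^ 'd" and A where "linear L" "A \<subseteq> range L"
    "(int (dim (range L))) simplex A" "S = L -` A" "K \<subseteq> S"
    "\<And>G. G facet_of A \<Longrightarrow> \<exists>F. F facet_of K \<and> F \<subseteq> L -` G"
proof (cases "supporting_simplex K S")
  case True
  thus ?thesis
    by (intro that[of id S]) (auto simp: supporting_simplex_def linear_id)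
next
  case False
  hence "supporting_strip K S" using assms by (simp add: SK_def)
  thus ?thesis unfolding supporting_strip_def using that by blast
qed

text \<open>Each facet hyperplane of the cross-section pulls back to one containing a facet of
  \<open>K\<close>, so its halfspace is already in \<open>H\<close>; \<open>S\<close> is thus an
  intersection of members of the finite \<open>H\<close>.\<close>

lemma finite_SK: "finite (SK K)"
proof (rule finite_subset)
  show "SK K \<subseteq> Inter ` Pow H"
  proof
    fix S assume "S \<in> SK K"
    then obtain L :: "real ^ 'd \<Rightarrow> real ^ 'd" and A where L: "linear L" "A \<subseteq> range L"
      "(int (dim (range L))) simplex A" "S = L -` A" "K \<subseteq> S"
      "\<And>G. G facet_of A \<Longrightarrow> \<exists>F. F facet_of K \<and> F \<subseteq> L -` G"
      using SK_linear_preimage by blast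
    have sub: "subspace (range L)" using L(1) by (simp add: linear_subspace_image)
    have adA: "aff_dim A = int (dim (range L))" using L(3) by (rule aff_dim_simplex)
    hence "A \<noteq> {}" by auto
    have affA: "affine hull A = range L"
    proof (rule affine_dim_equal)
      show "affine hull A \<subseteq> range L" using L(2) sub by (intro hull_minimal subspace_imp_affine)
      show "aff_dim (affine hull A) = aff_dim (range L)" using adA sub by (simp add: aff_dim_subspace)
    qed (use sub \<open>A \<noteq> {}\<close> in \<open>auto intro: subspace_imp_affine\<close>)
    have "polyhedron A" using L(3) by (intro polytope_imp_polyhedron simplex_imp_polytope)
    then obtain H' a' b' where H': "A = affine hull A \<inter> \<Inter>H'"
      "\<And>h. h \<in> H' \<Longrightarrow> a' h \<noteq> 0 \<and> h = {x. a' h \<bullet> x \<le> b' h}"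
      "\<And>C. C facet_of A \<longleftrightarrow> (\<exists>h\<in>H'. C = A \<inter> {x. a' h \<bullet> x = b' h})"
      using polyhedron_facet_representation by metis
    obtain x0 where x0: "x0 \<in> K" "\<forall>h\<in>H. a h \<bullet> x0 < b h" using strict_point by blast
    have "L -` h' \<in> H" if h': "h' \<in> H'" for h'
    proof -
      define G where "G = A \<inter> {x. a' h' \<bullet> x = b' h'}"
      have G: "G facet_of A" unfolding H'(3) G_def using h' by blast
      then obtain F where F: "F facet_of K" "F \<subseteq> L -` G" using L(6) by blast
      then obtain h where h: "h \<in> H" "F = K \<inter> {x. a h \<bullet> x = b h}" unfolding facets by blast
      have Lc: "adjoint L (a' h') \<bullet> x = a' h' \<bullet> L x" for x
        using adjoint_works[OF L(1), of x "a' h'"] by (simp add: inner_commute)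
      have pre: "L -` h' = {x. adjoint L (a' h') \<bullet> x \<le> b' h'}"
        using H'(2)[OF h'] unfolding Lc by auto
      have "{x. adjoint L (a' h') \<bullet> x \<le> b' h'} = {x. a h \<bullet> x \<le> b h}"
      proof (rule halfspace_eq_of_facet)
        show "a h \<noteq> 0" using halfspace h by blast
        show "a h \<bullet> x0 < b h" using x0 h by blast
        have "L x0 \<in> A" using x0 L(4,5) by blast
        hence "L x0 \<in> h'" using H'(1) h' by blast
        thus "adjoint L (a' h') \<bullet> x0 \<le> b' h'" using pre by blast
        show "F \<noteq> {}" using F by (simp add: facet_of_def)
        show "aff_dim F = int DIM(real ^ 'd) - 1" using F full_dim by (simp add: facet_of_def)
        show "F \<subseteq> {x. a h \<bullet> x = b h}" using h by blast
        show "F \<subseteq> {x. adjoint L (a' h') \<bullet> x = b' h'}" using F(2) unfolding G_def Lc by blast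
        \<comment> \<open>Otherwise \<open>a' h'\<close> vanishes on \<open>A\<close>, and the facet
          would be all of \<open>A\<close>.\<close>
        show "adjoint L (a' h') \<noteq> 0"
        proof
          assume z: "adjoint L (a' h') = 0"
          have "a' h' \<bullet> y = 0" if "y \<in> A" for y using that L(2) Lc z by force
          moreover have "G \<noteq> {}" using G by (simp add: facet_of_def)
          ultimately have "G = A" unfolding G_def by fastforce
          thus False using G by (simp add: facet_of_def)
        qed
      qed
      thus ?thesis using pre halfspace h by metis
    qed
    moreover have "S = \<Inter>((\<lambda>h'. L -` h') ` H')"
      unfolding L(4) by (subst H'(1)) (auto simp: affA)
    ultimately show "S \<in> Inter ` Pow H" by blast
  qed
qed (use finH in auto)

end

section \<open>Inscribed ellipses and the comparison of extremal functions\<close>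

text \<open>\<open>\<alpha>\<close> is the value of a facet function at the centre, \<open>X\<close>
  and \<open>Y\<close> the parts of its value at \<open>z\<close>, and
  \<open>2 * norm \<gamma>\<close> its amplitude on the ellipse. Squaring \<open>le\<close> gives
  the amplitude bound after cancellation.\<close>

lemma ellipse_tangency:
  fixes C S X Y \<alpha> :: real and \<gamma> :: complex
  assumes S: "S > 0" and C: "C > 0" "C\<^sup>2 = 1 + S\<^sup>2"
    and le: "C * norm (Complex X Y) - X \<le> S\<^sup>2 * \<alpha>"
    and \<gamma>: "Re \<gamma> = (\<alpha> - X) / (2 * C)" "Im \<gamma> = - Y / (2 * S)"
  shows "2 * norm \<gamma> \<le> \<alpha>"
proof -
  define N where "N = norm (Complex X Y)"
  have N2: "N\<^sup>2 = X\<^sup>2 + Y\<^sup>2" by (simp add: N_def cmod_power2)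
  have C1: "C \<ge> 1" using C S by (smt (verit) one_power2 power2_le_imp_le zero_le_power2)
  have "X \<le> N" unfolding N_def using complex_Re_le_cmod[of "Complex X Y"] by simp
  also have "N \<le> C * N" using mult_right_mono[OF C1, of N] by (simp add: N_def)
  finally have "0 \<le> S\<^sup>2 * \<alpha>" using le by (simp add: N_def)
  hence \<alpha>: "0 \<le> \<alpha>" using S by (simp add: zero_le_mult_iff)
  have "(C * N)\<^sup>2 \<le> (S\<^sup>2 * \<alpha> + X)\<^sup>2"
    using le C by (intro power_mono) (auto simp: N_def)
  hence "C\<^sup>2 * (X\<^sup>2 + Y\<^sup>2) \<le> (S\<^sup>2 * \<alpha> + X)\<^sup>2" by (simp add: power_mult_distrib N2)
  moreover have "(S\<^sup>2 * \<alpha> + X)\<^sup>2 - C\<^sup>2 * (X\<^sup>2 + Y\<^sup>2) = C\<^sup>2 * S\<^sup>2 * \<alpha>\<^sup>2 - S\<^sup>2 * (\<alpha> - X)\<^sup>2 - C\<^sup>2 * Y\<^sup>2"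
    unfolding C(2) by (simp add: power2_eq_square algebra_simps)
  ultimately have key: "S\<^sup>2 * (\<alpha> - X)\<^sup>2 + C\<^sup>2 * Y\<^sup>2 \<le> C\<^sup>2 * S\<^sup>2 * \<alpha>\<^sup>2" by linarith
  have "(2 * norm \<gamma>)\<^sup>2 = (2 * Re \<gamma>)\<^sup>2 + (2 * Im \<gamma>)\<^sup>2"
    by (simp add: power_mult_distrib cmod_power2)
  also have "2 * Re \<gamma> = (\<alpha> - X) / C" unfolding \<gamma> using C by (simp add: field_simps)
  also have "2 * Im \<gamma> = - (Y / S)" unfolding \<gamma> using S by (simp add: field_simps)
  also have "((\<alpha> - X) / C)\<^sup>2 + (- (Y / S))\<^sup>2 = ((\<alpha> - X) / C)\<^sup>2 + (Y / S)\<^sup>2" by simp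
  also have "\<dots> = (S\<^sup>2 * (\<alpha> - X)\<^sup>2 + C\<^sup>2 * Y\<^sup>2) / (C\<^sup>2 * S\<^sup>2)"
    using C(1) S by (simp add: power_divide field_simps)
  also have "\<dots> \<le> \<alpha>\<^sup>2"
    using key C(1) S by (simp add: pos_divide_le_eq mult_ac)
  finally show ?thesis using \<alpha> by (rule power2_le_imp_le)
qed

lemma extremal_antimono: "E \<subseteq> E' \<Longrightarrow> extremal E' z \<le> extremal E z"
  unfolding extremal_def by (rule Sup_subset_mono) blast

context full_polytope
begin

lemma extremal_le_of_center:
  fixes z :: "complex ^ 'd" and t :: real
  assumes t: "t > 0"
    and x: "\<And>h. h \<in> H \<Longrightarrow> (cosh t * norm (caffine (b h) (- a h) z) - Re (caffine (b h) (- a h) z)) / (sinh t)\<^sup>2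
               \<le> b h - a h \<bullet> x"
  shows "extremal (cvec ` K) z \<le> ereal t"
  unfolding extremal_def
proof (rule Sup_least, clarify)
  fix u :: "complex ^ 'd \<Rightarrow> ereal"
  assume u: "lelong u" and u0: "\<forall>w\<in>cvec ` K. u w \<le> 0"
  define C S where "C = cosh t" and "S = sinh t"
  have CS: "C > 0" "S > 0" "C\<^sup>2 = 1 + S\<^sup>2"
    using t by (auto simp: C_def S_def cosh_square_eq)
  \<comment> \<open>Solved from \<open>f (exp t) = z\<close>: real parts of \<open>c\<close> are
    multiplied by \<open>exp t + exp (- t)\<close>, imaginary parts by
    \<open>exp t - exp (- t)\<close>.\<close>
  define c where "c = (\<chi> i. Complex ((Re (z $ i) - x $ i) / (2 * C)) (Im (z $ i) / (2 * S)))"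
  define c' where "c' = (\<chi> i. cnj (c $ i))"
  have "u (cvec x + of_real (exp t) *s c + of_real (1 / exp t) *s c') \<le> ereal (ln (exp t))"
  proof (rule lelong_le_on_ellipse[OF u])
    fix \<zeta> :: complex assume \<zeta>: "norm \<zeta> = 1"
    define y where "y = (\<chi> i. x $ i + 2 * Re (\<zeta> * c $ i))"
    have "inverse \<zeta> = cnj \<zeta>" using \<zeta> by (simp add: inverse_complex_def complex_eq_iff cmod_power2[symmetric])
    hence "cvec x + \<zeta> *s c + inverse \<zeta> *s c' = cvec y"
      by (simp add: vec_eq_iff cvec_def y_def c'_def complex_eq_iff)
    moreover have "y \<in> K"
      unfolding mem_K
    proof
      fix h assume h: "h \<in> H"
      define w where "w = caffine (b h) (- a h) z"
      define \<gamma> where "\<gamma> = (\<Sum>i\<in>UNIV. of_real (a h $ i) * c $ i)"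
      have Rew: "Re w = b h - (\<Sum>i\<in>UNIV. a h $ i * Re (z $ i))"
        and Imw: "Im w = - (\<Sum>i\<in>UNIV. a h $ i * Im (z $ i))"
        by (simp_all add: w_def caffine_def sum_negf)
      have "Re \<gamma> = (\<Sum>i\<in>UNIV. (a h $ i * Re (z $ i) - a h $ i * x $ i) / (2 * C))"
        by (simp add: \<gamma>_def c_def algebra_simps)
      also have "\<dots> = ((b h - a h \<bullet> x) - Re w) / (2 * C)"
        by (simp add: Rew inner_vec_def sum_subtractf flip: sum_divide_distrib)
      finally have Re\<gamma>: "Re \<gamma> = ((b h - a h \<bullet> x) - Re w) / (2 * C)" .
      have "Im \<gamma> = (\<Sum>i\<in>UNIV. a h $ i * Im (z $ i) / (2 * S))"
        by (simp add: \<gamma>_def c_def)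
      also have "\<dots> = - Im w / (2 * S)" by (simp add: Imw flip: sum_divide_distrib)
      finally have Im\<gamma>: "Im \<gamma> = - Im w / (2 * S)" .
      have "2 * norm \<gamma> \<le> b h - a h \<bullet> x"
      proof (rule ellipse_tangency[OF CS(2,1,3) _ Re\<gamma> Im\<gamma>])
        show "C * norm (Complex (Re w) (Im w)) - Re w \<le> S\<^sup>2 * (b h - a h \<bullet> x)"
          using x[OF h] CS(2) by (simp add: w_def C_def S_def pos_divide_le_eq mult.commute)
      qed
      moreover have "a h \<bullet> y = a h \<bullet> x + 2 * Re (\<zeta> * \<gamma>)"
        unfolding \<gamma>_def y_def inner_vec_def sum_distrib_left Re_sum sum.distrib[symmetric]
        by (intro sum.cong) (simp_all add: algebra_simps)
      moreover have "Re (\<zeta> * \<gamma>) \<le> norm \<gamma>"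
        using complex_Re_le_cmod[of "\<zeta> * \<gamma>"] \<zeta> by (simp add: norm_mult)
      ultimately show "a h \<bullet> y \<le> b h" by linarith
    qed
    ultimately show "u (cvec x + \<zeta> *s c + inverse \<zeta> *s c') \<le> 0" using u0 by auto
  qed (use t in simp)
  also have "cvec x + of_real (exp t) *s c + of_real (1 / exp t) *s c' = z"
  proof -
    have "exp t + 1 / exp t = 2 * C" "exp t - 1 / exp t = 2 * S"
      by (simp_all add: C_def S_def cosh_def sinh_def exp_minus inverse_eq_divide)
    moreover have "Re (of_real (exp t) * c $ i + of_real (1 / exp t) * c' $ i) = (exp t + 1 / exp t) * Re (c $ i)"
       "Im (of_real (exp t) * c $ i + of_real (1 / exp t) * c' $ i) = (exp t - 1 / exp t) * Im (c $ i)" for i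
      by (simp_all only: c'_def vec_lambda_beta plus_complex.sel Re_complex_of_real Im_complex_of_real
           times_complex.sel cnj.sel) (simp_all add: algebra_simps)
    ultimately show ?thesis
      using CS by (simp only: vec_eq_iff complex_eq_iff) (simp add: cvec_def c_def add.assoc)
  qed
  finally show "u z \<le> ereal t" by simp
qed

text \<open>On the real set the summands are nonnegative reals of sum 1, so the candidate is
  \<open>arcosh 1 = 0\<close> there.\<close>

lemma arcosh_le_extremal:
  fixes z :: "complex ^ 'd"
  assumes J: "finite J" and \<mu>: "\<And>h. h \<in> J \<Longrightarrow> 0 < \<mu> h"
    and a0: "(\<Sum>h\<in>J. \<mu> h *\<^sub>R a h) = 0" and b1: "(\<Sum>h\<in>J. \<mu> h * b h) = 1"
  shows "ereal (arcosh (\<Sum>h\<in>J. \<mu> h * norm (caffine (b h) (- a h) z)))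
           \<le> extremal (cvec ` {x. \<forall>h\<in>J. a h \<bullet> x \<le> b h}) z"
proof -
  define u :: "complex ^ 'd \<Rightarrow> real" where
    "u = (\<lambda>z. arcosh (\<Sum>h\<in>J. norm (caffine (\<mu> h * b h) (\<mu> h *\<^sub>R - a h) z)))"
  have "lelong (\<lambda>z. ereal (u z))"
    unfolding u_def using a0 b1 by (intro lelong_arcosh_barycentric[OF J]) (simp_all add: sum_negf)
  moreover have "u (cvec x) = 0" if x: "\<forall>h\<in>J. a h \<bullet> x \<le> b h" for x
  proof -
    have "norm (caffine (\<mu> h * b h) (\<mu> h *\<^sub>R - a h) (cvec x)) = \<mu> h * (b h - a h \<bullet> x)" if "h \<in> J" for h
    proof -
      have "caffine (\<mu> h * b h) (\<mu> h *\<^sub>R - a h) (cvec x) = of_real (\<mu> h * (b h - a h \<bullet> x))"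
        unfolding caffine_cvec by (simp add: algebra_simps)
      moreover have "0 \<le> \<mu> h * (b h - a h \<bullet> x)"
        using \<mu>[OF that] x that by (intro mult_nonneg_nonneg) auto
      ultimately show ?thesis by (simp only: norm_of_real abs_of_nonneg)
    qed
    hence "(\<Sum>h\<in>J. norm (caffine (\<mu> h * b h) (\<mu> h *\<^sub>R - a h) (cvec x))) = (\<Sum>h\<in>J. \<mu> h * (b h - a h \<bullet> x))"
      by (intro sum.cong) auto
    also have "\<dots> = (\<Sum>h\<in>J. \<mu> h * b h) - (\<Sum>h\<in>J. \<mu> h *\<^sub>R a h) \<bullet> x"
      by (simp add: right_diff_distrib sum_subtractf inner_sum_left)
    finally show ?thesis using a0 b1 by (simp add: u_def)
  qed
  ultimately have "ereal (u z) \<le> extremal (cvec ` {x. \<forall>h\<in>J. a h \<bullet> x \<le> b h}) z"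
    unfolding extremal_def by (intro Sup_upper) (auto intro!: exI[of _ "\<lambda>z. ereal (u z)"])
  also have "u z = arcosh (\<Sum>h\<in>J. \<mu> h * norm (caffine (b h) (- a h) z))"
  proof -
    have "caffine (\<mu> h * b h) (\<mu> h *\<^sub>R - a h) z = of_real (\<mu> h) * caffine (b h) (- a h) z" for h
      by (simp add: caffine_def algebra_simps sum_distrib_left sum_negf)
    hence "norm (caffine (\<mu> h * b h) (\<mu> h *\<^sub>R - a h) z) = \<mu> h * norm (caffine (b h) (- a h) z)" if "h \<in> J" for h
      using \<mu>[OF that] by (simp add: norm_mult)
    thus ?thesis unfolding u_def by (intro arg_cong[of _ _ arcosh] sum.cong) auto
  qed
  finally show ?thesis .
qed

lemma extremal_dichotomy:
  fixes z :: "complex ^ 'd" and t :: real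
  assumes t: "t > 0"
  shows "extremal (cvec ` K) z \<le> ereal t \<or> (\<exists>S\<in>SK K. ereal t \<le> extremal (cvec ` S) z)"
proof -
  define l where "l = (\<lambda>h. caffine (b h) (- a h) z)"
  define \<beta> where "\<beta> = (\<lambda>h. (cosh t * norm (l h) - Re (l h)) / (sinh t)\<^sup>2)"
  show ?thesis
  proof (cases "\<exists>x. \<forall>h\<in>H. \<beta> h \<le> b h - a h \<bullet> x")
    case True
    thus ?thesis using extremal_le_of_center[OF t] by (auto simp: \<beta>_def l_def)
  next
    case False
    from inconsistent_system_circuit[OF this] obtain J \<mu> where
      J: "J \<subseteq> H" "\<forall>h\<in>J. 0 < \<mu> h" "(\<Sum>h\<in>J. \<mu> h *\<^sub>R a h) = 0" "(\<Sum>h\<in>J. \<mu> h * b h) = 1"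
         "1 < (\<Sum>h\<in>J. \<mu> h * \<beta> h)" and S: "{x. \<forall>h\<in>J. a h \<bullet> x \<le> b h} \<in> SK K" by blast
    have fin: "finite J" using J(1) finH by (rule finite_subset)
    define X where "X = (\<Sum>h\<in>J. \<mu> h * norm (l h))"
    have "(\<Sum>h\<in>J. of_real (\<mu> h) * l h) = (\<Sum>h\<in>J. caffine (\<mu> h * b h) (\<mu> h *\<^sub>R - a h) z)"
      by (simp add: l_def caffine_def algebra_simps sum_distrib_left sum_negf)
    also have "\<dots> = 1" using J(3,4) by (intro sum_caffine) (simp_all add: sum_negf)
    finally have "Re (\<Sum>h\<in>J. of_real (\<mu> h) * l h) = 1" by simp
    hence re1: "(\<Sum>h\<in>J. \<mu> h * Re (l h)) = 1" by simp
    have sh: "(sinh t)\<^sup>2 > 0" using t by simp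
    have "(\<Sum>h\<in>J. \<mu> h * \<beta> h) = (\<Sum>h\<in>J. \<mu> h * (cosh t * norm (l h) - Re (l h))) / (sinh t)\<^sup>2"
      by (simp add: \<beta>_def sum_divide_distrib)
    also have "(\<Sum>h\<in>J. \<mu> h * (cosh t * norm (l h) - Re (l h))) = cosh t * X - 1"
      by (simp add: X_def right_diff_distrib sum_subtractf re1 sum_distrib_left mult.left_commute)
    \<comment> \<open>Adding 1 turns the left side into \<open>cosh^2\<close>, and one factor
      \<open>cosh t\<close> cancels.\<close>
    finally have "(sinh t)\<^sup>2 < cosh t * X - 1" using J(5) sh by (simp add: less_divide_eq)
    hence "cosh t * cosh t < cosh t * X" using cosh_square_eq[of t] by (simp only: power2_eq_square)
    hence X: "cosh t < X" using cosh_real_pos[of t] by (simp only: mult_less_cancel_left_pos)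
    have "t = arcosh (cosh t)" using t by (simp add: arcosh_cosh_real)
    also have "\<dots> \<le> arcosh X"
      by (rule less_imp_le[OF arcosh_real_strict_mono]) (use X cosh_real_ge_1[of t] in auto)
    finally have "ereal t \<le> ereal (arcosh X)" by simp
    also have "\<dots> \<le> extremal (cvec ` {x. \<forall>h\<in>J. a h \<bullet> x \<le> b h}) z"
      unfolding X_def l_def using J by (intro arcosh_le_extremal fin) auto
    finally show ?thesis using S by blast
  qed
qed

text \<open>Ensures that a level above the maximum is positive, as the dichotomy requires. The
  competitor 0 is \<open>arcosh\<close> of the constant 1.\<close>

lemma extremal_nonneg_SK: "\<exists>S\<in>SK K. 0 \<le> extremal (cvec ` S) z"
proof -
  have "\<exists>S. S \<in> SK K" using SK_nonempty by blast
  then obtain S where S: "S \<in> SK K" by blast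
  have "lelong (\<lambda>w::complex^'d. ereal (arcosh (\<Sum>i\<in>{()}. norm (caffine 1 0 w))))"
    by (rule lelong_arcosh_barycentric) auto
  moreover have "arcosh (\<Sum>i\<in>{()}. norm (caffine 1 0 w)) = 0" for w :: "complex ^ 'd"
    by (simp add: caffine_def)
  ultimately have "lelong (\<lambda>_::complex^'d. 0)" by (simp add: zero_ereal_def)
  hence "0 \<le> extremal (cvec ` S) z"
    unfolding extremal_def by (intro Sup_upper) (auto intro!: exI[of _ "\<lambda>_. 0"])
  thus ?thesis using S by blast
qed

lemma extremal_eq_Max:
  "extremal (cvec ` K) z = Max ((\<lambda>S. extremal (cvec ` S) z) ` SK K)" (is "_ = ?M")
proof (rule antisym)
  have fin: "finite ((\<lambda>S. extremal (cvec ` S) z) ` SK K)" using finite_SK by simp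
  show "?M \<le> extremal (cvec ` K) z"
  proof (subst Max_le_iff[OF fin])
    have "K \<subseteq> S" if "S \<in> SK K" for S using that by (auto elim: SK_linear_preimage)
    thus "\<forall>v\<in>(\<lambda>S. extremal (cvec ` S) z) ` SK K. v \<le> extremal (cvec ` K) z"
      by (auto intro!: extremal_antimono image_mono)
  qed (use SK_nonempty in auto)
  have upper: "extremal (cvec ` S) z \<le> ?M" if "S \<in> SK K" for S using fin that by (intro Max_ge) auto
  show "extremal (cvec ` K) z \<le> ?M"
  proof (rule ccontr)
    assume "\<not> ?thesis"
    then obtain t where t: "?M < ereal t" "ereal t < extremal (cvec ` K) z"
      using ereal_dense2[of ?M "extremal (cvec ` K) z"] by (auto simp: not_le)
    obtain S where "S \<in> SK K" "0 \<le> extremal (cvec ` S) z" using extremal_nonneg_SK by blast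
    hence "0 < ereal t" using upper[of S] t(1) by (meson order_trans order_le_less_trans)
    hence "t > 0" by simp
    from extremal_dichotomy[OF this, of z] show False using t upper by (meson leD order_trans order_le_less_trans)
  qed
qed

end

theorem theorem6p7:
  fixes K :: "(real ^ 'd) set" and z :: "complex ^ 'd"
  assumes "polytope K" and "aff_dim K = int CARD('d)"
  shows "finite (SK K) \<and> SK K \<noteq> {} \<and>
         extremal (cvec ` K) z = Max ((\<lambda>S. extremal (cvec ` S) z) ` SK K)"
proof -
  have "polyhedron K" using assms(1) by (rule polytope_imp_polyhedron)
  then obtain H a b where H: "finite H" "K = affine hull K \<inter> \<Inter>H"
    "\<And>h. h \<in> H \<Longrightarrow> a h \<noteq> 0 \<and> h = {x. a h \<bullet> x \<le> b h}"
    "\<And>C. C facet_of K \<longleftrightarrow> (\<exists>h\<in>H. C = K \<inter> {x. a h \<bullet> x = b h})"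
    by (rule polyhedron_facet_representation) blast
  moreover have "affine hull K = UNIV" using assms(2) aff_dim_eq_full[of K] by simp
  ultimately interpret full_polytope K H a b
    using assms by unfold_locales auto
  show ?thesis using finite_SK SK_nonempty extremal_eq_Max by blast
qed

end
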